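(* Assume that $f$ is of heterogeneous KPP type and close-to-periodic, and let $u_0$ be an initial datum with $0\le u_0\le p$ which is not identically equal to $0$. Then the solution $u(t,x)$ of $\partial_t u=\partial_{xx}u+f(x,u)$ in $(0,+\infty)\times\mathbb{R}$ with $u(0,\cdot)=u_0$ converges to $p$ as $t\to+\infty$, locally uniformly in $x\in\mathbb{R}$.
   Context: Standing assumptions on a reaction term $f=f(x,u)$: $f$ is locally Lipschitz-continuous in $u$, $f(x,0)\equiv 0$, and $f$ is of class $C^1$ in a neighborhood of $u=0$ uniformly with respect to $x$ (so $\partial_u f(x,0)$ is well defined). Heterogeneous KPP type means: (i) for all $s_2>s_1>0$, $\inf_{x\in\mathbb{R}}\left(\frac{f(x,s_1)}{s_1}-\frac{f(x,s_2)}{s_2}\right)>0$; (ii) there exists a unique $p\in L^\infty(\mathbb{R},(0,+\infty))$ such that $\liminf_{x\to+\infty}p(x)>0$ and $\partial_{xx}p+f(x,p)=0$. Close-to-periodic means: there exist $L>0$, a function $\tilde f(x,u)$ satisfying the same standing assumptions and the same KPP hypotheses, $L$-periodic in $x$, and a constant $C>0$ such that for all $x\in\mathbb{R}$ and $u\ge 0$, $$|f(x,u)-\tilde f(x,u)|\le C e^{-2\lambda_* x}u .$$ Here $\lambda_*$ is defined from $\tilde f$ as follows. For $\lambda\in\mathbb{R}$, $\tilde\mu(\lambda)$ is the principal eigenvalue of $$-\partial_{xx}\phi_\lambda+2\lambda\,\partial_x\phi_\lambda-\partial_u\tilde f(x,0)\phi_\lambda=\tilde\mu(\lambda)\phi_\lambda\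 \text{in }\mathbb{R},\qquad \phi_\lambda>0\ \text{and } L\text{-periodic},$$ with $\tilde\mu(0)<0$ assumed (as part of $\tilde f$ being KPP); $c^*:=\min_{\lambda>0}\frac{\lambda^2-\tilde\mu(\lambda)}{\lambda}>0$; and $\lambda_*>0$ is the unique solution of $\lambda_*^2-c^*\lambda_*=\tilde\mu(\lambda_* )$. *)

theory Defs
  imports "HOL-Analysis.Analysis"
begin

(* Reaction terms f(x,u) are functions real => real => real of which only the values at u >= 0
   are ever used.  Accordingly the derivative in u is one-sided at u = 0. *)
definition du :: "(real \<Rightarrow> real \<Rightarrow> real) \<Rightarrow> real \<Rightarrow> real \<Rightarrow> real" where
  "du f x u = vector_derivative (f x) (at u within {0..})"

(* "Locally Lipschitz in u" is uniform in x, as needed for well-posedness of the Cauchy problem.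
   "C^1 near u = 0 uniformly in x": on an interval [0, \<delta>] independent of x, f(x,.) is
   differentiable with a derivative whose modulus of continuity is independent of x. *)
definition standing_assumptions :: "(real \<Rightarrow> real \<Rightarrow> real) \<Rightarrow> bool" where
  "standing_assumptions f \<longleftrightarrow>
     (\<forall>M. \<exists>K. \<forall>x. K-lipschitz_on {0..M} (f x)) \<and>
     (\<forall>x. f x 0 = 0) \<and>
     (\<exists>\<delta>>0.
        (\<forall>x. \<forall>u\<in>{0..\<delta>}. f x differentiable (at u within {0..})) \<and>
        (\<forall>\<epsilon>>0. \<exists>\<eta>>0. \<forall>x. \<forall>u\<in>{0..\<delta>}. \<forall>v\<in>{0..\<delta>}.
            \<bar>u - v\<bar> < \<eta> \<longrightarrow> \<bar>du f x u - du f x v\<bar> < \<epsilon>))"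

definition C2 :: "(real \<Rightarrow> real) \<Rightarrow> bool" where
  "C2 g \<longleftrightarrow>
     (\<forall>x. g field_differentiable (at x)) \<and>
     (\<forall>x. deriv g field_differentiable (at x)) \<and>
     continuous_on UNIV (deriv (deriv g))"

definition steady_state :: "(real \<Rightarrow> real \<Rightarrow> real) \<Rightarrow> (real \<Rightarrow> real) \<Rightarrow> bool" where
  "steady_state f p \<longleftrightarrow>
     C2 p \<and> bounded (range p) \<and> (\<forall>x. p x > 0) \<and>
     Liminf at_top (\<lambda>x. ereal (p x)) > 0 \<and>
     (\<forall>x. deriv (deriv p) x + f x (p x) = 0)"

(* The infimum is taken in ereal because it may be -\<infinity>. *)
definition heterogeneous_KPP :: "(real \<Rightarrow> real \<Rightarrow> real) \<Rightarrow> bool" where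
  "heterogeneous_KPP f \<longleftrightarrow>
     (\<forall>s1 s2. 0 < s1 \<and> s1 < s2 \<longrightarrow> (INF x. ereal (f x s1 / s1 - f x s2 / s2)) > 0) \<and>
     (\<exists>!p. steady_state f p)"

(* m is the eigenvalue of  -\<phi>'' + 2 l \<phi>' - g \<phi> = m \<phi>  belonging to a positive L-periodic
   eigenfunction. *)
definition principal_eigenvalue :: "(real \<Rightarrow> real) \<Rightarrow> real \<Rightarrow> real \<Rightarrow> real \<Rightarrow> bool" where
  "principal_eigenvalue g L l m \<longleftrightarrow>
     (\<exists>\<phi>. C2 \<phi> \<and> (\<forall>x. \<phi> x > 0) \<and> (\<forall>x. \<phi> (x + L) = \<phi> x) \<and>
          (\<forall>x. - deriv (deriv \<phi>) x + 2 * l * deriv \<phi> x - g x * \<phi> x = m * \<phi> x))"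

definition is_min_speed :: "(real \<Rightarrow> real) \<Rightarrow> real \<Rightarrow> bool" where
  "is_min_speed \<mu> c \<longleftrightarrow>
     (\<exists>l>0. c = (l\<^sup>2 - \<mu> l) / l) \<and> (\<forall>l>0. c \<le> (l\<^sup>2 - \<mu> l) / l)"

definition is_critical_decay :: "(real \<Rightarrow> real) \<Rightarrow> real \<Rightarrow> real \<Rightarrow> bool" where
  "is_critical_decay \<mu> c l \<longleftrightarrow>
     l > 0 \<and> l\<^sup>2 - c * l = \<mu> l \<and> (\<forall>l'>0. l'\<^sup>2 - c * l' = \<mu> l' \<longrightarrow> l' = l)"

definition close_to_periodic :: "(real \<Rightarrow> real \<Rightarrow> real) \<Rightarrow> bool" where
  "close_to_periodic f \<longleftrightarrow>
     (\<exists>L ft \<mu> c lstar C. L > 0 \<and>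
        standing_assumptions ft \<and> heterogeneous_KPP ft \<and>
        (\<forall>x. \<forall>u\<ge>0. ft (x + L) u = ft x u) \<and>
        (\<forall>l. principal_eigenvalue (\<lambda>x. du ft x 0) L l (\<mu> l)) \<and> \<mu> 0 < 0 \<and>
        is_min_speed \<mu> c \<and> c > 0 \<and>
        is_critical_decay \<mu> c lstar \<and>
        C > 0 \<and> (\<forall>x. \<forall>u\<ge>0. \<bar>f x u - ft x u\<bar> \<le> C * exp (- 2 * lstar * x) * u))"

(* Classical solutions u(t,x) of  u_t = u_xx + f(x,u)  for t > 0 with u(0,.) = u0, in the
   usual uniqueness class: nonnegative (f(x,.) only lives on [0,\<infinity>)) and bounded on bounded time
   intervals.  As u0 is merely an L^\<infinity> function, it is attained in L^1_loc; for continuous u0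
   this includes all bounded solutions that are continuous up to t = 0. *)
definition cauchy_solution ::
  "(real \<Rightarrow> real \<Rightarrow> real) \<Rightarrow> (real \<Rightarrow> real) \<Rightarrow> (real \<Rightarrow> real \<Rightarrow> real) \<Rightarrow> bool" where
  "cauchy_solution f u0 u \<longleftrightarrow>
     (\<forall>t>0. \<forall>x. (\<lambda>s. u s x) field_differentiable (at t)) \<and>
     (\<forall>t>0. C2 (u t)) \<and>
     continuous_on ({0<..} \<times> UNIV) (\<lambda>(t, x). u t x) \<and>
     continuous_on ({0<..} \<times> UNIV) (\<lambda>(t, x). deriv (\<lambda>s. u s x) t) \<and>
     continuous_on ({0<..} \<times> UNIV) (\<lambda>(t, x). deriv (u t) x) \<and>
     continuous_on ({0<..} \<times> UNIV) (\<lambda>(t, x). deriv (deriv (u t)) x) \<and>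
     (\<forall>t>0. \<forall>x. deriv (\<lambda>s. u s x) t = deriv (deriv (u t)) x + f x (u t x)) \<and>
     (\<forall>t>0. \<forall>x. u t x \<ge> 0) \<and>
     (\<forall>T. bounded ((\<lambda>(t, x). u t x) ` ({0<..T} \<times> UNIV))) \<and>
     u 0 = u0 \<and>
     (\<forall>R. ((\<lambda>t. LINT x:{-R..R}|lebesgue. \<bar>u t x - u0 x\<bar>) \<longlongrightarrow> 0) (at_right 0))"

end

theory Submission
  imports Defs
begin

text \<open>
  Comparison with \<open>p\<close> gives \<open>u \<le> p\<close>. For the lower bound, write a candidate subsolution as
  \<open>w = p h(z)\<close> with \<open>z' = 1/p\<^sup>2\<close>. Since \<open>p\<close> is a steady state, the first order terms cancel and
  \<open>w'' + f(x,w) = w (h''/(h p\<^sup>4) + f(x,w)/w - f(x,p)/p)\<close>, where the last difference is positive by the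
  KPP property as long as \<open>h < 1\<close>, uniformly where \<open>p\<close> is bounded away from 0. As \<open>p\<close> stays away from 0
  near \<open>+\<infinity>\<close>, a slowly varying cosine is an admissible \<open>h\<close> far to the right, and it forces \<open>u\<close> up to
  \<open>(1-\<eta>) p\<close> at a point \<open>x1\<close>. To the left of \<open>x1\<close>, where \<open>p\<close> may decay, one takes \<open>h\<close> affine, so that
  \<open>h'' = 0\<close>; a small slope carries the bound over to any given compact set. Multiplying a strict
  subsolution by a slowly growing exponential in time lifts \<open>u\<close> above it in finite time.
\<close>

subsection \<open>Minimum principle\<close>

text \<open>By Fermat, \<open>g'\<close> vanishes at \<open>x\<close>. If \<open>d\<close> were
  negative, \<open>g'\<close> would be negative just to the right of \<open>x\<close>, and the mean
  value theorem would produce a smaller value of \<open>g\<close> there.\<close>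

lemma second_derivative_nonneg_at_minimum:
  fixes g g' :: "real \<Rightarrow> real"
  assumes "a < x" "x < b"
    and dg: "\<And>y. a < y \<Longrightarrow> y < b \<Longrightarrow> (g has_real_derivative g' y) (at y)"
    and dg': "(g' has_real_derivative d) (at x)"
    and min: "\<And>y. a < y \<Longrightarrow> y < b \<Longrightarrow> g x \<le> g y"
  shows "0 \<le> d"
proof (rule ccontr)
  assume "\<not> 0 \<le> d"
  have "g' x = 0"
  proof (rule DERIV_local_min)
    show "(g has_real_derivative g' x) (at x)"
      using dg assms(1,2) by blast
    show "0 < min (x - a) (b - x)"
      using assms(1,2) by simp
    show "\<forall>y. \<bar>x - y\<bar> < min (x - a) (b - x) \<longrightarrow> g x \<le> g y"
      by (auto intro!: min)
  qed
  obtain e where e: "0 < e" "\<And>h. 0 < h \<Longrightarrow> h < e \<Longrightarrow> g' (x + h) < g' x"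
    using DERIV_neg_dec_right[OF dg'] \<open>\<not> 0 \<le> d\<close> by auto
  define y where "y = x + min e (b - x) / 2"
  have y: "x < y" "y < b" "y - x < e"
    using e(1) assms(2) by (auto simp: y_def min_def field_simps)
  obtain \<xi> where \<xi>: "x < \<xi>" "\<xi> < y" "g y - g x = (y - x) * g' \<xi>"
    using MVT2[OF y(1), of g g'] dg assms(1) y by force
  have "g' \<xi> < 0"
    using e(2)[of "\<xi> - x"] \<xi> y \<open>g' x = 0\<close> by simp
  then have "g y < g x"
    using \<xi>(3) y(1) mult_pos_neg[of "y - x" "g' \<xi>"] by simp
  then show False
    using min[of y] y assms(1) by auto
qed

text \<open>A negative minimum of the damped function \<open>D\<close> lies off the parabolic
  boundary. There \<open>vxx\<close> is nonnegative and \<open>vt \<le> (K + 1) * v\<close>, so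
  \<open>ineq\<close> would give \<open>vxx \<le> v < 0\<close>. Demanding \<open>ineq\<close> only
  where \<open>v < 0\<close> lets barriers be used that are subsolutions only on their positivity
  set.\<close>

lemma parabolic_minimum_principle:
  fixes v vt vx vxx :: "real \<Rightarrow> real \<Rightarrow> real"
  assumes cont: "continuous_on ({t1..t2} \<times> {a..b}) (\<lambda>(t, x). v t x)"
    and init: "\<And>x. x \<in> {a..b} \<Longrightarrow> 0 \<le> v t1 x"
    and bdry: "\<And>t. t \<in> {t1..t2} \<Longrightarrow> 0 \<le> v t a" "\<And>t. t \<in> {t1..t2} \<Longrightarrow> 0 \<le> v t b"
    and dt: "\<And>t x. t1 < t \<Longrightarrow> t \<le> t2 \<Longrightarrow> a < x \<Longrightarrow> x < b \<Longrightarrow>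
               ((\<lambda>s. v s x) has_real_derivative vt t x) (at t)"
    and dx: "\<And>t x. t1 < t \<Longrightarrow> t \<le> t2 \<Longrightarrow> a < x \<Longrightarrow> x < b \<Longrightarrow>
               (v t has_real_derivative vx t x) (at x)"
    and dxx: "\<And>t x. t1 < t \<Longrightarrow> t \<le> t2 \<Longrightarrow> a < x \<Longrightarrow> x < b \<Longrightarrow>
               (vx t has_real_derivative vxx t x) (at x)"
    and ineq: "\<And>t x. t1 < t \<Longrightarrow> t \<le> t2 \<Longrightarrow> a < x \<Longrightarrow> x < b \<Longrightarrow> v t x < 0 \<Longrightarrow>
               vxx t x + K * v t x \<le> vt t x"
    and tx: "t \<in> {t1..t2}" "x \<in> {a..b}"
  shows "0 \<le> v t x"
proof (rule ccontr)
  assume neg: "\<not> 0 \<le> v t x"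
  \<comment> \<open>The rate \<open>K + 1\<close> exceeds \<open>K\<close> by one; this surplus
    \<open>v s y < 0\<close> is what makes the final contradiction strict.\<close>
  define D where "D = (\<lambda>t x. exp (- (K + 1) * t) * v t x)"
  have "continuous_on ({t1..t2} \<times> {a..b}) (\<lambda>(t, x). D t x)"
    using cont unfolding D_def case_prod_unfold by (intro continuous_intros)
  moreover have "compact ({t1..t2} \<times> {a..b})" "{t1..t2} \<times> {a..b} \<noteq> {}"
    using tx by (auto intro: compact_Times)
  ultimately obtain z where z: "z \<in> {t1..t2} \<times> {a..b}"
    "\<forall>y\<in>{t1..t2} \<times> {a..b}. (\<lambda>(t, x). D t x) z \<le> (\<lambda>(t, x). D t x) y"
    using continuous_attains_inf[of "{t1..t2} \<times> {a..b}" "\<lambda>(t, x). D t x"]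
    by blast
  obtain s y where sy: "z = (s, y)" by force
  have min: "D s y \<le> D s' y'" if "s' \<in> {t1..t2}" "y' \<in> {a..b}" for s' y'
    using z(2) that unfolding sy by force
  have s: "s \<in> {t1..t2}" and y: "y \<in> {a..b}"
    using z(1) sy by auto
  have "D t x < 0"
    using neg unfolding D_def by (simp add: mult_pos_neg)
  with min[OF tx] have "D s y < 0" by simp
  then have v: "v s y < 0"
    unfolding D_def by (simp add: mult_less_0_iff)
  then have "t1 < s" "a < y" "y < b"
    using init[OF y] bdry[OF s] s y by (auto simp: less_le)
  have "0 \<le> vxx s y"
  proof (rule second_derivative_nonneg_at_minimum[OF \<open>a < y\<close> \<open>y < b\<close>])
    show "(v s has_real_derivative vx s y') (at y')" if "a < y'" "y' < b" for y'
      using dx that \<open>t1 < s\<close> s by simp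
    show "(vx s has_real_derivative vxx s y) (at y)"
      using dxx \<open>a < y\<close> \<open>y < b\<close> \<open>t1 < s\<close> s by simp
    show "v s y \<le> v s y'" if "a < y'" "y' < b" for y'
      using min[OF s, of y'] that unfolding D_def by simp
  qed
  \<comment> \<open>The minimum may sit at the final time \<open>t2\<close>, so \<open>D s y\<close>
    is compared with earlier times only.\<close>
  have "vt s y \<le> (K + 1) * v s y"
  proof (rule ccontr)
    assume *: "\<not> vt s y \<le> (K + 1) * v s y"
    have "((\<lambda>t. D t y) has_real_derivative exp (- (K + 1) * s) * (vt s y - (K + 1) * v s y)) (at s)"
      unfolding D_def using dt[OF \<open>t1 < s\<close> _ \<open>a < y\<close> \<open>y < b\<close>] s
      by (auto intro!: derivative_eq_intros simp: algebra_simps)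
    moreover have "0 < exp (- (K + 1) * s) * (vt s y - (K + 1) * v s y)"
      using * by simp
    ultimately obtain e where e: "0 < e" "\<And>h. 0 < h \<Longrightarrow> h < e \<Longrightarrow> D (s - h) y < D s y"
      using DERIV_pos_inc_left by blast
    define h where "h = min e (s - t1) / 2"
    have "0 < h" "h < e" "s - h \<in> {t1..t2}"
      using e(1) \<open>t1 < s\<close> s by (auto simp: h_def min_def field_simps)
    then show False
      using e(2)[of h] min[of "s - h" y] y by simp
  qed
  then show False
    using ineq[OF \<open>t1 < s\<close> _ \<open>a < y\<close> \<open>y < b\<close> v] s v \<open>0 \<le> vxx s y\<close> by (auto simp: algebra_simps)
qed

text \<open>At 0 the difference quotient is \<open>(max 0 h) ^ (n - 1)\<close>, which tends to 0,
  times a factor bounded by 1. Applied to \<open>n = 3\<close> and then \<open>n = 2\<close>, it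
  shows that the cube of a positive part is twice differentiable in the barrier and in the energy
  below.\<close>

lemma has_real_derivative_pos_part_power:
  fixes x :: real
  assumes "2 \<le> n"
  shows "((\<lambda>x. (max 0 x) ^ n) has_real_derivative real n * (max 0 x) ^ (n - 1)) (at x)"
proof (cases "x = 0")
  case True
  have eq: "(\<lambda>h::real. ((max 0 (0 + h)) ^ n - (max 0 0) ^ n) / h) = (\<lambda>h. (max 0 h) ^ (n - 1) * (max 0 h / h))"
    using assms by (cases n) (auto simp: power_0_left)
  have lim: "((\<lambda>h::real. (max 0 h) ^ (n - 1) * (max 0 h / h)) \<longlongrightarrow> 0) (at 0)"
  proof (rule Lim_null_comparison)
    have "norm ((max 0 h) ^ (n - 1) * (max 0 h / h)) \<le> (max 0 h) ^ (n - 1)" for h :: real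
    proof -
      have "\<bar>max 0 h / h\<bar> \<le> 1"
        by (auto simp: max_def)
      then show ?thesis
        using mult_left_le[of "\<bar>max 0 h / h\<bar>" "(max 0 h) ^ (n - 1)"] by (simp add: abs_mult)
    qed
    then show "\<forall>\<^sub>F h::real in at 0. norm ((max 0 h) ^ (n - 1) * (max 0 h / h)) \<le> (max 0 h) ^ (n - 1)"
      by simp
    have "((\<lambda>h::real. (max 0 h) ^ (n - 1)) \<longlongrightarrow> (max 0 0) ^ (n - 1)) (at 0)"
      by (intro tendsto_intros)
    moreover have "(max 0 (0::real)) ^ (n - 1) = 0"
      using assms by simp
    ultimately show "((\<lambda>h::real. (max 0 h) ^ (n - 1)) \<longlongrightarrow> 0) (at 0)"
      by metis
  qed
  have "real n * (max 0 0) ^ (n - 1) = 0"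
    using assms by (simp add: power_0_left)
  then show ?thesis
    unfolding True DERIV_def eq using lim by (simp only:)
next
  case False
  show ?thesis
  proof (cases "x < 0")
    case True
    have "((\<lambda>x. 0) has_real_derivative 0) (at x)" by simp
    moreover have "\<forall>\<^sub>F y in nhds x. (0::real) = (max 0 y) ^ n"
      by (rule eventually_mono[OF eventually_nhds_in_open[of "{..<0}" x]]) (use True assms in auto)
    ultimately have "((\<lambda>x. (max 0 x) ^ n) has_real_derivative 0) (at x)"
      by (subst DERIV_cong_ev[OF refl _ refl, symmetric])
    then show ?thesis using True assms by (simp add: power_0_left)
  next
    case False
    with \<open>x \<noteq> 0\<close> have "x > 0" by simp
    have "((\<lambda>x. x ^ n) has_real_derivative real n * x ^ (n - 1)) (at x)"
      by (auto intro!: derivative_eq_intros)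
    moreover have "\<forall>\<^sub>F y in nhds x. y ^ n = (max 0 y) ^ n"
      by (rule eventually_mono[OF eventually_nhds_in_open[of "{0<..}" x]]) (use \<open>x > 0\<close> in auto)
    ultimately have "((\<lambda>x. (max 0 x) ^ n) has_real_derivative real n * x ^ (n - 1)) (at x)"
      by (subst DERIV_cong_ev[OF refl _ refl, symmetric])
    then show ?thesis using \<open>x > 0\<close> by simp
  qed
qed

section \<open>Regularity and bounds read off from the definitions\<close>

lemma cauchy_solutionD:
  assumes "cauchy_solution f u0 u" "0 < t"
  shows "((\<lambda>s. u s x) has_real_derivative deriv (deriv (u t)) x + f x (u t x)) (at t)"
    and "(u t has_real_derivative deriv (u t) x) (at x)"
    and "(deriv (u t) has_real_derivative deriv (deriv (u t)) x) (at x)"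
    and "0 \<le> u t x"
  using assms unfolding cauchy_solution_def C2_def
  by (metis DERIV_deriv_iff_field_differentiable)+

lemma cauchy_solution_continuous:
  assumes "cauchy_solution f u0 u" "A \<subseteq> {0<..} \<times> UNIV"
  shows "continuous_on A (\<lambda>(t, x). u t x)"
  using assms continuous_on_subset unfolding cauchy_solution_def by blast

lemma steady_stateD:
  assumes "steady_state f p"
  shows "(p has_real_derivative deriv p x) (at x)"
    and "(deriv p has_real_derivative - f x (p x)) (at x)"
    and "0 < p x"
  using assms unfolding steady_state_def C2_def
  by (metis DERIV_deriv_iff_field_differentiable add_eq_0_iff2)+

lemma steady_state_bounded:
  assumes "steady_state f p"
  obtains M where "0 < M" "\<And>x. p x \<le> M"
proof -
  obtain M where "\<forall>y\<in>range p. \<bar>y\<bar> \<le> M"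
    using assms unfolding steady_state_def bounded_real by blast
  then have "p x \<le> max 1 M" for x
    by (metis abs_le_D1 max.coboundedI2 rangeI)
  then show ?thesis by (intro that[of "max 1 M"]) auto
qed

lemma standing_assumptions_lipschitz:
  assumes "standing_assumptions f"
  obtains K where "0 \<le> K"
    "\<And>x a b. 0 \<le> a \<Longrightarrow> a \<le> M \<Longrightarrow> 0 \<le> b \<Longrightarrow> b \<le> M \<Longrightarrow> \<bar>f x a - f x b\<bar> \<le> K * \<bar>a - b\<bar>"
proof -
  obtain K where K: "\<And>x. K-lipschitz_on {0..M} (f x)"
    using assms unfolding standing_assumptions_def by blast
  show ?thesis
  proof (rule that)
    show "0 \<le> K" using K lipschitz_on_nonneg by blast
    show "\<bar>f x a - f x b\<bar> \<le> K * \<bar>a - b\<bar>" if "0 \<le> a" "a \<le> M" "0 \<le> b" "b \<le> M" for x a b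
      using lipschitz_onD[OF K, of a b x] that by (simp add: dist_real_def)
  qed
qed

subsection \<open>Positivity\<close>

text \<open>
  The barrier is \<open>(r\<^sup>2 - (x - y(t))\<^sup>2)\<^sup>3\<close> on its positivity set, damped exponentially in time, where
  \<open>y\<close> moves linearly from \<open>x1\<close> to \<open>x2\<close>; the cube makes it \<open>C\<^sup>2\<close>.
\<close>
lemma solution_positive:
  assumes sol: "cauchy_solution f u0 u"
    and t: "0 < t1" "t1 < t2"
    and lower: "\<And>t x. t1 \<le> t \<Longrightarrow> t \<le> t2 \<Longrightarrow> - K * u t x \<le> f x (u t x)"
    and pos: "0 < u t1 x1"
  shows "0 < u t2 x2"
proof -
  have "continuous_on UNIV (u t1)"
    using cauchy_solutionD(2)[OF sol t(1)] DERIV_isCont continuous_at_imp_continuous_on by blast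
  then obtain r where r: "0 < r" "\<And>x. \<bar>x - x1\<bar> < r \<Longrightarrow> \<bar>u t1 x - u t1 x1\<bar> < u t1 x1 / 2"
    using pos unfolding continuous_on_iff dist_real_def by (metis UNIV_I half_gt_zero)
  \<comment> \<open>The speed that carries the centre of the barrier from \<open>x1\<close> at time
    \<open>t1\<close> to \<open>x2\<close> at time \<open>t2\<close>.\<close>
  define c where "c = (x2 - x1) / (t2 - t1)"
  define \<xi> where "\<xi> = (\<lambda>t x. x - (x1 + c * (t - t1)))"
  define Q where "Q = (\<lambda>t x. max 0 (r\<^sup>2 - (\<xi> t x)\<^sup>2))"
  \<comment> \<open>\<open>B\<close> dominates \<open>6 * c * \<xi> + 6 + 24\<close> on the support,
    where \<open>\<bar>\<xi>\<bar> \<le> r\<close>. In \<open>\<beta>\<close>, the term added to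
    \<open>K\<close> is the least \<open>\<alpha>\<close> for which
    \<open>\<alpha> * Q\<^sup>2 - B * Q + 24 * r\<^sup>2\<close> is nonnegative for every
    \<open>Q\<close>, namely a perfect square.\<close>
  define B where "B = 6 * (r * \<bar>c\<bar> + 1) + 24"
  define \<beta> where "\<beta> = K + B\<^sup>2 / (96 * r\<^sup>2)"
  \<comment> \<open>The maximum of the initial barrier is \<open>C * r ^ 6\<close>, half of
    \<open>u t1 x1\<close>; by the choice of \<open>r\<close>, \<open>u t1\<close> stays above this
    value on the initial support.\<close>
  define C where "C = u t1 x1 / (2 * r ^ 6)"
  define E where "E = (\<lambda>t. C * exp (- \<beta> * (t - t1)))"
  define w where "w = (\<lambda>t x. E t * (Q t x) ^ 3)"
  define wt where "wt = (\<lambda>t x. E t * (- \<beta> * (Q t x) ^ 3 + 6 * c * \<xi> t x * (Q t x)\<^sup>2))"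
  define wx where "wx = (\<lambda>t x. E t * (- 6 * \<xi> t x * (Q t x)\<^sup>2))"
  define wxx where "wxx = (\<lambda>t x. E t * (24 * (\<xi> t x)\<^sup>2 * Q t x - 6 * (Q t x)\<^sup>2))"
  have E: "0 < E t" for t
    using pos r(1) by (simp add: E_def C_def)
  have dQ3: "((\<lambda>x. (max 0 (g x)) ^ 3) has_real_derivative 3 * (max 0 (g x))\<^sup>2 * g') (at x)"
    and dQ2: "((\<lambda>x. (max 0 (g x))\<^sup>2) has_real_derivative 2 * (max 0 (g x)) * g') (at x)"
    if "(g has_real_derivative g') (at x)" for g g' x
    using DERIV_chain2[OF has_real_derivative_pos_part_power[of 3] that]
      DERIV_chain2[OF has_real_derivative_pos_part_power[of 2] that] by simp_all
  have wt: "((\<lambda>s. w s x) has_real_derivative wt t x) (at t)" for t x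
  proof -
    have "((\<lambda>s. r\<^sup>2 - (\<xi> s x)\<^sup>2) has_real_derivative 2 * c * \<xi> t x) (at t)"
      unfolding \<xi>_def by (auto intro!: derivative_eq_intros simp: algebra_simps)
    from dQ3[OF this] have dQ: "((\<lambda>s. (Q s x) ^ 3) has_real_derivative 6 * c * \<xi> t x * (Q t x)\<^sup>2) (at t)"
      unfolding Q_def by (simp add: mult_ac)
    have dE: "(E has_real_derivative - \<beta> * E t) (at t)"
      unfolding E_def by (auto intro!: derivative_eq_intros simp: algebra_simps)
    show ?thesis
      unfolding w_def wt_def
      by (rule DERIV_cong[OF DERIV_mult[OF dE dQ]]) (simp add: algebra_simps)
  qed
  have d\<xi>: "(\<xi> t has_real_derivative 1) (at x)" for t x
    unfolding \<xi>_def by (auto intro!: derivative_eq_intros)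
  have dq: "((\<lambda>x. r\<^sup>2 - (\<xi> t x)\<^sup>2) has_real_derivative - 2 * \<xi> t x) (at x)" for t x
    unfolding \<xi>_def by (auto intro!: derivative_eq_intros simp: algebra_simps)
  have wx: "(w t has_real_derivative wx t x) (at x)" for t x
    using DERIV_cmult[OF dQ3[OF dq], of "E t" t x] unfolding w_def wx_def Q_def
    by (simp add: mult_ac)
  have wxx: "(wx t has_real_derivative wxx t x) (at x)" for t x
  proof -
    have dQ: "((\<lambda>x. (Q t x)\<^sup>2) has_real_derivative 2 * Q t x * (- 2 * \<xi> t x)) (at x)"
      using dQ2[OF dq] unfolding Q_def .
    show ?thesis
      unfolding wx_def wxx_def
      by (rule DERIV_cong[OF DERIV_cmult[OF DERIV_mult[OF DERIV_cmult[OF d\<xi>] dQ]]])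
        (simp add: algebra_simps power2_eq_square)
  qed
  \<comment> \<open>After division by \<open>E t * Q t x\<close> the claim is quadratic in
    \<open>Q\<close>. Near the edge of the support the diffusion term
    \<open>24 * \<xi>\<^sup>2\<close> dominates, inside it the damping \<open>\<beta>\<close> does;
    substituting \<open>\<xi>\<^sup>2 = r\<^sup>2 - Q\<close> treats both at once.\<close>
  have sub: "wt t x \<le> wxx t x - K * w t x" if "0 < Q t x" for t x
  proof -
    let ?Q = "Q t x" and ?\<xi> = "\<xi> t x"
    have Q: "?Q = r\<^sup>2 - ?\<xi>\<^sup>2"
      using that unfolding Q_def by (simp add: max_def split: if_splits)
    then have "?\<xi>\<^sup>2 = r\<^sup>2 - ?Q" by simp
    then have "?\<xi>\<^sup>2 \<le> r\<^sup>2" using that by simp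
    then have "\<bar>?\<xi>\<bar> \<le> r"
      using r(1) abs_le_square_iff[of ?\<xi> r] by simp
    then have "\<bar>c\<bar> * \<bar>?\<xi>\<bar> \<le> \<bar>c\<bar> * r"
      by (intro mult_left_mono) auto
    moreover have "c * ?\<xi> \<le> \<bar>c\<bar> * \<bar>?\<xi>\<bar>"
      by (simp flip: abs_mult)
    ultimately have "c * ?\<xi> \<le> r * \<bar>c\<bar>"
      by (simp add: mult.commute)
    then have "(6 * c * ?\<xi> + 6 + 24) * ?Q \<le> B * ?Q"
      unfolding B_def using that by (intro mult_right_mono) auto
    moreover have "B * ?Q \<le> B\<^sup>2 / (96 * r\<^sup>2) * ?Q\<^sup>2 + 24 * r\<^sup>2"
    proof -
      have "B\<^sup>2 / (96 * r\<^sup>2) * ?Q\<^sup>2 - B * ?Q + 24 * r\<^sup>2 = 24 * r\<^sup>2 * (1 - B * ?Q / (48 * r\<^sup>2))\<^sup>2"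
        using r(1) by (simp add: field_simps power2_eq_square)
      moreover have "0 \<le> 24 * r\<^sup>2 * (1 - B * ?Q / (48 * r\<^sup>2))\<^sup>2"
        by simp
      ultimately show ?thesis by linarith
    qed
    ultimately have "(6 * c * ?\<xi> + 6) * ?Q \<le> (\<beta> - K) * ?Q\<^sup>2 + 24 * ?\<xi>\<^sup>2"
      using \<open>?\<xi>\<^sup>2 = r\<^sup>2 - ?Q\<close> unfolding \<beta>_def by (simp add: algebra_simps)
    then have "?Q * ((6 * c * ?\<xi> + 6) * ?Q) \<le> ?Q * ((\<beta> - K) * ?Q\<^sup>2 + 24 * ?\<xi>\<^sup>2)"
      using that by (intro mult_left_mono) auto
    then have "- \<beta> * ?Q ^ 3 + 6 * c * ?\<xi> * ?Q\<^sup>2 \<le> 24 * ?\<xi>\<^sup>2 * ?Q - 6 * ?Q\<^sup>2 - K * ?Q ^ 3"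
      by (simp add: algebra_simps power2_eq_square power3_eq_cube)
    from mult_left_mono[OF this, of "E t"] E[of t] show ?thesis
      unfolding wt_def wxx_def w_def by (simp add: algebra_simps)
  qed
  \<comment> \<open>The centre stays between \<open>x1\<close> and \<open>x2\<close>, so both
    endpoints remain at distance at least \<open>r\<close> from it and the barrier vanishes on the
    lateral boundary.\<close>
  let ?a = "min x1 x2 - r" and ?b = "max x1 x2 + r"
  have "0 \<le> u t2 x2 - w t2 x2"
  proof (rule parabolic_minimum_principle[where v = "\<lambda>t x. u t x - w t x" and ?t1.0 = t1 and ?t2.0 = t2
        and a = ?a and b = ?b and K = "- K"
        and vt = "\<lambda>t x. deriv (deriv (u t)) x + f x (u t x) - wt t x"
        and vx = "\<lambda>t x. deriv (u t) x - wx t x"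
        and vxx = "\<lambda>t x. deriv (deriv (u t)) x - wxx t x"])
    have "continuous_on ({t1..t2} \<times> {?a..?b}) (\<lambda>(t, x). w t x)"
      unfolding w_def E_def Q_def \<xi>_def case_prod_unfold by (intro continuous_intros)
    moreover have "continuous_on ({t1..t2} \<times> {?a..?b}) (\<lambda>(t, x). u t x)"
      using t by (intro cauchy_solution_continuous[OF sol]) auto
    ultimately show "continuous_on ({t1..t2} \<times> {?a..?b}) (\<lambda>(t, x). u t x - w t x)"
      unfolding case_prod_unfold by (rule continuous_on_diff[rotated])
    show "0 \<le> u t1 x - w t1 x" for x
    proof (cases "\<bar>x - x1\<bar> < r")
      case True
      have "Q t1 x \<le> r\<^sup>2" "0 \<le> Q t1 x"
        by (auto simp: Q_def)
      then have "(Q t1 x) ^ 3 \<le> (r\<^sup>2) ^ 3"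
        by (intro power_mono)
      then have "w t1 x \<le> E t1 * r ^ 6"
        unfolding w_def using E[of t1] by (auto simp flip: power_mult)
      also have "\<dots> = u t1 x1 / 2"
        using r(1) by (simp add: E_def C_def)
      finally show ?thesis
        using r(2)[OF True] by linarith
    next
      case False
      then have "r\<^sup>2 \<le> (x - x1)\<^sup>2"
        using r(1) abs_le_square_iff[of r "x - x1"] by simp
      then have "Q t1 x = 0"
        by (simp add: Q_def \<xi>_def)
      then show ?thesis
        using cauchy_solutionD(4)[OF sol t(1)] by (simp add: w_def)
    qed
    have Q0: "Q t ?a = 0 \<and> Q t ?b = 0" if "t \<in> {t1..t2}" for t
    proof -
      define l where "l = (t - t1) / (t2 - t1)"
      have l: "0 \<le> l" "l \<le> 1" using that t by (auto simp: l_def)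
      have y: "x1 + c * (t - t1) = (1 - l) * x1 + l * x2"
      proof -
        have "c * (t - t1) = l * (x2 - x1)"
          by (simp add: c_def l_def)
        then show ?thesis by (simp add: algebra_simps)
      qed
      have "(1 - l) * min x1 x2 + l * min x1 x2 \<le> (1 - l) * x1 + l * x2"
        "(1 - l) * x1 + l * x2 \<le> (1 - l) * max x1 x2 + l * max x1 x2"
        using l by (intro add_mono mult_left_mono; simp)+
      then have "r \<le> \<bar>\<xi> t ?a\<bar>" "r \<le> \<bar>\<xi> t ?b\<bar>"
        unfolding \<xi>_def y by (simp_all add: algebra_simps)
      then have "r\<^sup>2 \<le> (\<xi> t ?a)\<^sup>2" "r\<^sup>2 \<le> (\<xi> t ?b)\<^sup>2"
        using r(1) abs_le_square_iff[of r] by simp_all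
      then show ?thesis by (simp add: Q_def)
    qed
    show "0 \<le> u t ?a - w t ?a" "0 \<le> u t ?b - w t ?b" if "t \<in> {t1..t2}" for t
      using Q0[OF that] cauchy_solutionD(4)[OF sol, of t] that t by (simp_all add: w_def)
  next
    fix t x assume tx: "t1 < t" "t \<le> t2"
    then have "0 < t" using t by simp
    note D = cauchy_solutionD[OF sol this]
    show "((\<lambda>s. u s x - w s x) has_real_derivative deriv (deriv (u t)) x + f x (u t x) - wt t x) (at t)"
      by (intro DERIV_diff D wt)
    show "((\<lambda>x. u t x - w t x) has_real_derivative deriv (u t) x - wx t x) (at x)"
      by (intro DERIV_diff D wx)
    show "((\<lambda>x. deriv (u t) x - wx t x) has_real_derivative deriv (deriv (u t)) x - wxx t x) (at x)"
      by (intro DERIV_diff D wxx)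
    show "deriv (deriv (u t)) x - wxx t x + - K * (u t x - w t x)
        \<le> deriv (deriv (u t)) x + f x (u t x) - wt t x" if "u t x - w t x < 0"
    proof -
      \<comment> \<open>Since \<open>u\<close> is nonnegative, \<open>u < w\<close> forces the point
        into the support of the barrier, where \<open>sub\<close> is available.\<close>
      have "0 < w t x" using that D(4)[of x] by simp
      then have "Q t x \<noteq> 0" by (auto simp: w_def)
      then have "0 < Q t x" by (simp add: Q_def max_def split: if_splits)
      from sub[OF this] lower[of t x] tx show ?thesis by (simp add: algebra_simps)
    qed
  qed (use t r in auto)
  moreover have "0 < w t2 x2"
  proof -
    have "\<xi> t2 x2 = 0" using t by (simp add: \<xi>_def c_def)
    then show ?thesis using E r(1) by (simp add: w_def Q_def)
  qed
  ultimately show ?thesis by simp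
qed

subsection \<open>Consequences of the KPP property\<close>

text \<open>A real number strictly between 0 and the infimum over \<open>x\<close> serves as a gap
  common to all \<open>x\<close>.\<close>

lemma KPP_gap:
  assumes "heterogeneous_KPP f" "0 < s1" "s1 < s2"
  obtains \<delta> where "0 < \<delta>" "\<And>x. f x s2 / s2 + \<delta> \<le> f x s1 / s1"
proof -
  have "0 < (INF x. ereal (f x s1 / s1 - f x s2 / s2))"
    using conjunct1[OF assms(1)[unfolded heterogeneous_KPP_def], rule_format, OF conjI[OF assms(2,3)]] .
  from ereal_dense2[OF this] obtain \<delta> where
    \<delta>: "0 < ereal \<delta>" "ereal \<delta> < (INF x. ereal (f x s1 / s1 - f x s2 / s2))"
    by (elim exE conjE)
  have "ereal \<delta> \<le> ereal (f x s1 / s1 - f x s2 / s2)" for x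
    by (rule order_trans[OF less_imp_le[OF \<delta>(2)] INF_lower]) simp
  then have "f x s2 / s2 + \<delta> \<le> f x s1 / s1" for x
    by (simp only: ereal_less_eq algebra_simps)
  with \<delta>(1) show ?thesis by (intro that[of \<delta>]) simp_all
qed

lemma KPP_ratio_antimono:
  assumes "heterogeneous_KPP f" "0 < s1" "s1 \<le> s2"
  shows "f x s2 / s2 \<le> f x s1 / s1"
proof (cases "s1 = s2")
  case False
  then have "s1 < s2" using assms(3) by simp
  then obtain \<delta> where "0 < \<delta>" "f x s2 / s2 + \<delta> \<le> f x s1 / s1"
    using KPP_gap[OF assms(1,2)] by metis
  then show ?thesis by simp
qed simp

text \<open>Monotonicity of \<open>f x s / s\<close>, multiplied out. It means that shrinking a
  subsolution by a factor in (0, 1] leaves it a subsolution, which permits a time-dependent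
  amplitude in the comparison below.\<close>

lemma KPP_scale:
  assumes "heterogeneous_KPP f" "standing_assumptions f" "0 \<le> s" "0 < \<tau>" "\<tau> \<le> 1"
  shows "\<tau> * f x s \<le> f x (\<tau> * s)"
proof (cases "s = 0")
  case True
  then show ?thesis using assms(2) by (simp add: standing_assumptions_def)
next
  case False
  then have "f x s / s \<le> f x (\<tau> * s) / (\<tau> * s)"
    using assms by (intro KPP_ratio_antimono) (auto simp: mult_left_le_one_le)
  from mult_right_mono[OF this, of "\<tau> * s"] show ?thesis
    using False assms by (simp add: mult.commute)
qed

text \<open>The KPP property gives a gap for each fixed pair of values; here one gap must serve a
  whole range of pairs with ratio at most \<open>\<rho>\<close>. The interval from \<open>m\<close>
  to \<open>M\<close> is covered by finitely many geometric steps, and on each step monotonicity of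
  \<open>f x s / s\<close> reduces all pairs to a single one.\<close>

lemma KPP_uniform_gap:
  assumes kpp: "heterogeneous_KPP f" and "0 < m" "0 < \<rho>" "\<rho> < 1"
  obtains \<delta> where "0 < \<delta>"
    "\<And>x s s'. m \<le> s \<Longrightarrow> s \<le> M \<Longrightarrow> 0 < s' \<Longrightarrow> s' \<le> \<rho> * s \<Longrightarrow> f x s / s + \<delta> \<le> f x s' / s'"
proof -
  \<comment> \<open>The step ratio must satisfy both \<open>1 < q\<close>, so that the powers reach
    \<open>M\<close>, and \<open>\<rho> * q < 1\<close>, so that the pair
    \<open>\<rho> * q * s2 < s2\<close> is separated. The choice gives
    \<open>\<rho> * q = sqrt \<rho>\<close>.\<close>
  define q where "q = 1 / sqrt \<rho>"
  have q: "1 < q" "\<rho> * q * q = 1" "\<rho> * q < 1"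
    using assms by (simp_all add: q_def real_less_rsqrt real_div_sqrt)
  have "\<exists>\<delta>>0. \<forall>x s s'. m \<le> s \<longrightarrow> s \<le> m * q ^ n \<longrightarrow> 0 < s' \<longrightarrow> s' \<le> \<rho> * s \<longrightarrow>
          f x s / s + \<delta> \<le> f x s' / s'" for n
  proof (induction n)
    case 0
    obtain \<delta> where "0 < \<delta>" "\<And>x. f x m / m + \<delta> \<le> f x (\<rho> * m) / (\<rho> * m)"
      by (rule KPP_gap[OF kpp, of "\<rho> * m" m]) (use assms in auto)
    have "f x s / s + \<delta> \<le> f x s' / s'"
      if "m \<le> s" "s \<le> m * q ^ 0" "0 < s'" "s' \<le> \<rho> * s" for x s s'
    proof -
      have "s = m" using that by simp
      then show ?thesis
        using \<open>\<And>x. f x m / m + \<delta> \<le> f x (\<rho> * m) / (\<rho> * m)\<close>[of x]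
          KPP_ratio_antimono[OF kpp that(3), of "\<rho> * m" x] that by simp
    qed
    with \<open>0 < \<delta>\<close> show ?case by blast
  next
    case (Suc n)
    then obtain \<delta>1 where \<delta>1: "0 < \<delta>1" "\<And>x s s'. m \<le> s \<Longrightarrow> s \<le> m * q ^ n \<Longrightarrow> 0 < s' \<Longrightarrow> s' \<le> \<rho> * s \<Longrightarrow>
        f x s / s + \<delta>1 \<le> f x s' / s'"
      by blast
    define s2 where "s2 = m * q ^ n"
    have "0 < s2" using assms q(1) by (simp add: s2_def)
    obtain \<delta>2 where \<delta>2: "0 < \<delta>2" "\<And>x. f x s2 / s2 + \<delta>2 \<le> f x (\<rho> * q * s2) / (\<rho> * q * s2)"
      by (rule KPP_gap[OF kpp, of "\<rho> * q * s2" s2]) (use q assms \<open>0 < s2\<close> in auto)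
    have "f x s / s + min \<delta>1 \<delta>2 \<le> f x s' / s'"
      if s: "m \<le> s" "s \<le> m * q ^ Suc n" "0 < s'" "s' \<le> \<rho> * s" for x s s'
    proof (cases "s \<le> s2")
      case True
      then show ?thesis using \<delta>1(2)[of s s' x] s unfolding s2_def by simp
    next
      case False
      \<comment> \<open>On the new step, \<open>s'\<close> lies below \<open>\<rho> * q * s2\<close>
        and \<open>s\<close> above \<open>s2\<close>, so the gap for these two fixed values is
        inherited.\<close>
      have "\<rho> * s \<le> \<rho> * (q * s2)"
        using s(2) assms by (intro mult_left_mono) (auto simp: s2_def mult_ac)
      then have "f x (\<rho> * q * s2) / (\<rho> * q * s2) \<le> f x s' / s'"
        using s by (intro KPP_ratio_antimono[OF kpp]) (auto simp: mult_ac)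
      moreover have "f x s / s \<le> f x s2 / s2"
        using False \<open>0 < s2\<close> by (intro KPP_ratio_antimono[OF kpp]) auto
      ultimately show ?thesis using \<delta>2(2)[of x] by simp
    qed
    then show ?case using \<delta>1(1) \<delta>2(1) by (intro exI[of _ "min \<delta>1 \<delta>2"]) auto
  qed
  note gap = this
  obtain n where "M / m < q ^ n"
    using real_arch_pow[OF q(1)] by blast
  then have "M \<le> m * q ^ n"
    using assms by (simp add: field_simps)
  moreover obtain \<delta> where "0 < \<delta>" "\<And>x s s'. m \<le> s \<Longrightarrow> s \<le> m * q ^ n \<Longrightarrow> 0 < s' \<Longrightarrow> s' \<le> \<rho> * s \<Longrightarrow>
      f x s / s + \<delta> \<le> f x s' / s'"
    using gap[of n] by blast
  ultimately show ?thesis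
    by (intro that[of \<delta>]) auto
qed

text \<open>Comparison on \<open>[T, t]\<close> with \<open>exp (- \<gamma> (t - s)) w\<close>, which equals \<open>w\<close> at the final time \<open>s = t\<close>.\<close>
lemma solution_exceeds_subsolution:
  assumes kpp: "heterogeneous_KPP f" and sa: "standing_assumptions f"
    and sol: "cauchy_solution f u0 u"
    and "0 < T" "a \<le> b" "0 < \<gamma>"
    and bound: "\<And>t x. T \<le> t \<Longrightarrow> u t x \<le> M" "\<And>x. x \<in> {a..b} \<Longrightarrow> w x \<le> M"
    and pos: "\<And>x. x \<in> {a..b} \<Longrightarrow> 0 < u T x"
    and bdry: "\<And>t. T \<le> t \<Longrightarrow> w a \<le> u t a" "\<And>t. T \<le> t \<Longrightarrow> w b \<le> u t b"
    and w: "continuous_on {a..b} w" "\<And>x. x \<in> {a..b} \<Longrightarrow> 0 \<le> w x"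
    and dw: "\<And>x. a < x \<Longrightarrow> x < b \<Longrightarrow> (w has_real_derivative w' x) (at x)"
    and dw': "\<And>x. a < x \<Longrightarrow> x < b \<Longrightarrow> (w' has_real_derivative w'' x) (at x)"
    and sub: "\<And>x. a < x \<Longrightarrow> x < b \<Longrightarrow> \<gamma> * w x \<le> w'' x + f x (w x)"
  obtains T' where "T \<le> T'" "\<And>t x. T' \<le> t \<Longrightarrow> x \<in> {a..b} \<Longrightarrow> w x \<le> u t x"
proof -
  obtain K where K: "0 \<le> K" "\<And>x a b. 0 \<le> a \<Longrightarrow> a \<le> M \<Longrightarrow> 0 \<le> b \<Longrightarrow> b \<le> M \<Longrightarrow> \<bar>f x a - f x b\<bar> \<le> K * \<bar>a - b\<bar>"
    using standing_assumptions_lipschitz[OF sa] by blast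
  have "continuous_on {a..b} (u T)"
    using cauchy_solutionD(2)[OF sol \<open>0 < T\<close>] DERIV_isCont continuous_at_imp_continuous_on by blast
  then obtain x0 where x0: "x0 \<in> {a..b}" "\<And>x. x \<in> {a..b} \<Longrightarrow> u T x0 \<le> u T x"
    using continuous_attains_inf[of "{a..b}" "u T"] \<open>a \<le> b\<close> by auto
  have "0 < u T x0" using pos x0 by simp
  moreover have "u T x0 \<le> M" using bound(1) by simp
  ultimately have "0 < M" by simp
  \<comment> \<open>The waiting time after which \<open>exp (- \<gamma> * (t - T)) * M\<close>, a
    bound for the shrunken subsolution at time \<open>T\<close>, has dropped to the minimum
    \<open>u T x0\<close>.\<close>
  define T' where "T' = T + ln (M / u T x0) / \<gamma>"
  have "T \<le> T'"
    using \<open>0 < u T x0\<close> \<open>u T x0 \<le> M\<close> \<open>0 < \<gamma>\<close> by (simp add: T'_def)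
  moreover have "w x \<le> u t x" if t: "T' \<le> t" and x: "x \<in> {a..b}" for t x
  proof -
    define \<tau> where "\<tau> = (\<lambda>s. exp (- \<gamma> * (t - s)))"
    have \<tau>: "0 < \<tau> s" "s \<le> t \<Longrightarrow> \<tau> s \<le> 1" for s
      using \<open>0 < \<gamma>\<close> by (auto simp: \<tau>_def)
    have \<tau>w: "0 \<le> \<tau> s * w x" "s \<le> t \<Longrightarrow> \<tau> s * w x \<le> w x" if "x \<in> {a..b}" for s x
      using \<tau>[of s] w(2)[OF that] by (auto simp: mult_left_le_one_le less_imp_le)
    have d\<tau>: "(\<tau> has_real_derivative \<gamma> * \<tau> s) (at s)" for s
      unfolding \<tau>_def by (auto intro!: derivative_eq_intros)
    have "0 \<le> u t x - \<tau> t * w x"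
    proof (rule parabolic_minimum_principle[where v = "\<lambda>s x. u s x - \<tau> s * w x" and ?t1.0 = T and ?t2.0 = t
          and a = a and b = b and K = K
          and vt = "\<lambda>s x. deriv (deriv (u s)) x + f x (u s x) - \<gamma> * \<tau> s * w x"
          and vx = "\<lambda>s x. deriv (u s) x - \<tau> s * w' x"
          and vxx = "\<lambda>s x. deriv (deriv (u s)) x - \<tau> s * w'' x"])
      have "continuous_on ({T..t} \<times> {a..b}) (\<lambda>z. w (snd z))"
        by (rule continuous_on_compose2[OF w(1)]) (auto intro: continuous_intros)
      then have "continuous_on ({T..t} \<times> {a..b}) (\<lambda>(s, x). \<tau> s * w x)"
        unfolding \<tau>_def case_prod_unfold by (intro continuous_intros)
      moreover have "continuous_on ({T..t} \<times> {a..b}) (\<lambda>(s, x). u s x)"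
        using \<open>0 < T\<close> by (intro cauchy_solution_continuous[OF sol]) auto
      ultimately show "continuous_on ({T..t} \<times> {a..b}) (\<lambda>(s, x). u s x - \<tau> s * w x)"
        unfolding case_prod_unfold by (rule continuous_on_diff[rotated])
      show "0 \<le> u T x - \<tau> T * w x" if x: "x \<in> {a..b}" for x
      proof -
        have "ln (M / u T x0) \<le> \<gamma> * (t - T)"
          using t \<open>0 < \<gamma>\<close> by (simp add: T'_def field_simps)
        then have "\<tau> T \<le> exp (- ln (M / u T x0))"
          by (simp add: \<tau>_def)
        also have "\<dots> = u T x0 / M"
          using \<open>0 < M\<close> \<open>0 < u T x0\<close> by (simp add: exp_minus)
        finally have "\<tau> T * w x \<le> u T x0 / M * M"
          using bound(2)[OF x] w(2)[OF x] \<open>0 < M\<close> \<open>0 < u T x0\<close> by (intro mult_mono) auto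
        then show ?thesis using x0(2)[OF x] \<open>0 < M\<close> by simp
      qed
      show "0 \<le> u s a - \<tau> s * w a" "0 \<le> u s b - \<tau> s * w b" if "s \<in> {T..t}" for s
        using bdry[of s] \<tau>w(2)[of a s] \<tau>w(2)[of b s] that \<open>a \<le> b\<close> by auto
    next
      fix s x assume s: "T < s" "s \<le> t" and x: "a < x" "x < b"
      then have "0 < s" using \<open>0 < T\<close> by simp
      note D = cauchy_solutionD[OF sol this]
      show "((\<lambda>s. u s x - \<tau> s * w x) has_real_derivative deriv (deriv (u s)) x + f x (u s x) - \<gamma> * \<tau> s * w x) (at s)"
        by (intro DERIV_diff D DERIV_cmult_right d\<tau>)
      show "((\<lambda>x. u s x - \<tau> s * w x) has_real_derivative deriv (u s) x - \<tau> s * w' x) (at x)"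
        by (intro DERIV_diff D DERIV_cmult dw x)
      show "((\<lambda>x. deriv (u s) x - \<tau> s * w' x) has_real_derivative deriv (deriv (u s)) x - \<tau> s * w'' x) (at x)"
        by (intro DERIV_diff D DERIV_cmult dw' x)
      show "deriv (deriv (u s)) x - \<tau> s * w'' x + K * (u s x - \<tau> s * w x)
          \<le> deriv (deriv (u s)) x + f x (u s x) - \<gamma> * \<tau> s * w x" if neg: "u s x - \<tau> s * w x < 0"
      proof -
        \<comment> \<open>The amplitude grows at rate \<open>\<gamma>\<close>, and the strictness
          margin \<open>\<gamma> * w\<close> pays exactly for this growth; \<open>KPP_scale\<close>
          then moves \<open>\<tau>\<close> inside \<open>f\<close>.\<close>
        have "\<tau> s * (\<gamma> * w x) \<le> \<tau> s * (w'' x + f x (w x))"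
          using sub[OF x] \<tau>(1) by (intro mult_left_mono) (auto simp: less_imp_le)
        moreover have "\<tau> s * f x (w x) \<le> f x (\<tau> s * w x)"
          using x w(2)[of x] \<tau> s by (intro KPP_scale[OF kpp sa]) auto
        moreover have "\<bar>f x (u s x) - f x (\<tau> s * w x)\<bar> \<le> K * \<bar>u s x - \<tau> s * w x\<bar>"
          using D(4)[of x] bound(1)[of s x] bound(2)[of x] \<tau>w[of x s] s x by (intro K(2)) auto
        ultimately show ?thesis using neg by (simp add: algebra_simps)
      qed
    qed (use t x \<open>T \<le> T'\<close> in auto)
    then show ?thesis by (simp add: \<tau>_def)
  qed
  ultimately show ?thesis by (rule that)
qed

subsection \<open>Comparison with the steady state\<close>

text \<open>The integral of a non-integrable function is 0 by convention, so the \<open>L^1\<close>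
  initial condition carries information only once \<open>u0\<close> is known to be integrable on
  bounded intervals. The bound \<open>M\<close> provides this.\<close>

lemma initial_datum_set_integrable:
  fixes p u0 :: "real \<Rightarrow> real"
  assumes meas: "u0 \<in> borel_measurable lebesgue"
    and ae: "AE x in lebesgue. 0 \<le> u0 x \<and> u0 x \<le> p x"
    and M: "\<And>x. p x \<le> M"
  shows "set_integrable lebesgue {a..b} u0"
proof -
  have "set_integrable lebesgue {a..b} (\<lambda>x. M)"
    by (intro absolutely_integrable_continuous_real continuous_intros)
  then show ?thesis
    unfolding set_integrable_def
  proof (rule Bochner_Integration.integrable_bound)
    show "(\<lambda>x. indicator {a..b} x *\<^sub>R u0 x) \<in> borel_measurable lebesgue"
      by (intro borel_measurable_scaleR borel_measurable_indicator meas) simp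
    show "AE x in lebesgue. norm (indicator {a..b} x *\<^sub>R u0 x) \<le> norm (indicator {a..b} x *\<^sub>R M)"
      using ae
    proof (rule eventually_mono)
      show "norm (indicator {a..b} x *\<^sub>R u0 x) \<le> norm (indicator {a..b} x *\<^sub>R M)"
        if "0 \<le> u0 x \<and> u0 x \<le> p x" for x
        using that M[of x] by (auto simp: indicator_def)
    qed
  qed
qed

text \<open>
  As \<open>u0\<close> is attained only in \<open>L\<^sup>1\<close> on bounded sets, the minimum principle cannot start at time 0. Instead the
  localised energy \<open>E R s = \<integral> (1 - (x/R)\<^sup>2)\<^sup>2 (u - p)\<^sub>+\<^sup>3\<close> satisfies \<open>E' \<le> 3 K E + O(1/R)\<close> and starts at 0;
  the cube makes \<open>(u - p)\<^sub>+\<^sup>3\<close> a \<open>C\<^sup>2\<close> function, and the weight vanishes to second order at \<open>\<plusminus>R\<close>, so that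
  integration by parts leaves no boundary terms.
\<close>
lemma solution_le_steady_state:
  assumes sa: "standing_assumptions f"
    and sol: "cauchy_solution f u0 u"
    and st: "steady_state f p"
    and meas: "u0 \<in> borel_measurable lebesgue"
    and ae: "AE x in lebesgue. 0 \<le> u0 x \<and> u0 x \<le> p x"
    and t: "0 < t"
  shows "u t x0 \<le> p x0"
proof (rule ccontr)
  assume contra: "\<not> u t x0 \<le> p x0"
  obtain P where P: "0 < P" "\<And>x. p x \<le> P"
    using steady_state_bounded[OF st] by blast
  have "bounded ((\<lambda>(t, x). u t x) ` ({0<..t} \<times> UNIV))"
    using sol unfolding cauchy_solution_def by blast
  then obtain N where N: "\<forall>y\<in>(\<lambda>(t, x). u t x) ` ({0<..t} \<times> UNIV). \<bar>y\<bar> \<le> N"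
    unfolding bounded_real by blast
  \<comment> \<open>A common bound for \<open>p\<close> and for \<open>u\<close> up to time
    \<open>t\<close>, so that a single Lipschitz constant \<open>K\<close> applies to both.\<close>
  define M where "M = max P N"
  have "0 < M" "\<And>x. p x \<le> M"
    using P by (auto simp: M_def intro: max.coboundedI1)
  have uM: "u s x \<le> M" if "0 < s" "s \<le> t" for s x
  proof -
    have "u s x \<in> (\<lambda>(t, x). u t x) ` ({0<..t} \<times> UNIV)"
      using that by (intro image_eqI[of _ _ "(s, x)"]) auto
    with N have "\<bar>u s x\<bar> \<le> N" by (rule bspec)
    then show ?thesis by (simp add: M_def)
  qed
  obtain K where K: "0 \<le> K" "\<And>x a b. 0 \<le> a \<Longrightarrow> a \<le> M \<Longrightarrow> 0 \<le> b \<Longrightarrow> b \<le> M \<Longrightarrow> \<bar>f x a - f x b\<bar> \<le> K * \<bar>a - b\<bar>"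
    using standing_assumptions_lipschitz[OF sa] by blast
  note D = cauchy_solutionD[OF sol] and Dp = steady_stateD[OF st]
  define v where "v = (\<lambda>s x. max 0 (u s x - p x))"
  define ut where "ut = (\<lambda>s x. deriv (\<lambda>r. u r x) s)"
  have ut: "ut s x = deriv (deriv (u s)) x + f x (u s x)" if "0 < s" for s x
    unfolding ut_def using D(1)[OF that] by (rule DERIV_imp_deriv)
  have v: "0 \<le> v s x" "0 < s \<Longrightarrow> s \<le> t \<Longrightarrow> v s x \<le> M" for s x
    using uM[of s x] Dp(3)[of x] \<open>0 < M\<close> by (auto simp: v_def)
  have contu: "continuous_on UNIV (u s)" if "0 < s" for s
    using D(2)[OF that] DERIV_isCont continuous_at_imp_continuous_on by blast
  have contp: "continuous_on UNIV p"
    using Dp(1) DERIV_isCont continuous_at_imp_continuous_on by blast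
  have contv: "continuous_on A (v s)" if "0 < s" for s A
    unfolding v_def
    by (intro continuous_intros continuous_on_subset[OF contu[OF that]] continuous_on_subset[OF contp]) auto

  \<comment> \<open>Growth of the localised energy\<close>
  define E where "E = (\<lambda>R s. integral {-R..R} (\<lambda>x. (1 - (x / R)\<^sup>2)\<^sup>2 * v s x ^ 3))"
  \<comment> \<open>The bound \<open>8 / R\<^sup>2\<close> for the second derivative of the weight,
    times \<open>M ^ 3\<close>, times the length \<open>2 * R\<close>, gives
    \<open>16 * M ^ 3 / R\<close>; integration in time with Gronwall contributes the remaining
    factors.\<close>
  define c where "c = exp (3 * K * t) * (16 * M ^ 3 * t)"
  have "E R t \<le> c / R" if R: "0 < R" for R
  proof -
    define \<theta> where "\<theta> = (\<lambda>x. (1 - (x / R)\<^sup>2)\<^sup>2)"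
    define \<theta>1 where "\<theta>1 = (\<lambda>x. - 4 * x / R\<^sup>2 * (1 - (x / R)\<^sup>2))"
    define \<theta>2 where "\<theta>2 = (\<lambda>x. 8 * x\<^sup>2 / R ^ 4 - 4 / R\<^sup>2 * (1 - (x / R)\<^sup>2))"
    have d\<theta>: "(\<theta> has_real_derivative \<theta>1 x) (at x)" for x
      unfolding \<theta>_def \<theta>1_def using R
      by (auto intro!: derivative_eq_intros simp: field_simps power2_eq_square)
    have d\<theta>1: "(\<theta>1 has_real_derivative \<theta>2 x) (at x)" for x
      unfolding \<theta>1_def \<theta>2_def using R
      by (auto intro!: derivative_eq_intros simp: field_simps power2_eq_square power4_eq_xxxx)
    have cont\<theta>: "continuous_on A \<theta>" for A
      unfolding \<theta>_def using R by (intro continuous_intros) auto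
    have xR: "(x / R)\<^sup>2 \<le> 1" if "x \<in> {-R..R}" for x
      using that R by (simp add: abs_square_le_1 abs_le_iff)
    have \<theta>: "0 \<le> \<theta> x" "\<theta> x \<le> 1" "\<theta>2 x \<le> 8 / R\<^sup>2" if "x \<in> {-R..R}" for x
    proof -
      show "0 \<le> \<theta> x" by (simp add: \<theta>_def)
      show "\<theta> x \<le> 1" using xR[OF that] by (simp add: \<theta>_def abs_square_le_1)
      have "\<theta>2 x = 8 / R\<^sup>2 * (x / R)\<^sup>2 - 4 / R\<^sup>2 * (1 - (x / R)\<^sup>2)"
        using R by (simp add: \<theta>2_def field_simps power2_eq_square power4_eq_xxxx)
      also have "\<dots> \<le> 8 / R\<^sup>2 * 1 - 0"
        using xR[OF that] R by (intro diff_mono mult_left_mono) auto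
      finally show "\<theta>2 x \<le> 8 / R\<^sup>2" by simp
    qed
    define I where "I = (\<lambda>s. integral {-R..R} (\<lambda>x. \<theta> x * (3 * (v s x)\<^sup>2 * ut s x)))"
    have contI: "continuous_on ({0<..} \<times> {-R..R}) (\<lambda>(s, x). \<theta> x * (3 * (v s x)\<^sup>2 * ut s x))"
    proof -
      have "continuous_on ({0<..} \<times> {-R..R}) (\<lambda>z. u (fst z) (snd z))"
        using cauchy_solution_continuous[OF sol, of "{0<..} \<times> {-R..R}"]
        by (auto simp: case_prod_unfold)
      moreover have "continuous_on ({0<..} \<times> {-R..R}) (\<lambda>z. ut (fst z) (snd z))"
      proof (rule continuous_on_subset)
        show "continuous_on ({0<..} \<times> UNIV) (\<lambda>z. ut (fst z) (snd z))"
          using sol unfolding cauchy_solution_def ut_def case_prod_unfold by blast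
      qed auto
      moreover have "continuous_on ({0<..} \<times> {-R..R}) (\<lambda>z. p (snd z))"
        by (rule continuous_on_compose2[OF contp]) (auto intro: continuous_intros)
      moreover have "continuous_on ({0<..} \<times> {-R..R}) (\<lambda>z. \<theta> (snd z))"
        by (rule continuous_on_compose2[OF cont\<theta>]) (auto intro: continuous_intros)
      ultimately show ?thesis
        unfolding v_def case_prod_unfold by (intro continuous_intros)
    qed
    have dE: "(E R has_real_derivative I s) (at s)" if "0 < s" for s
    proof -
      have "((\<lambda>s. integral (cbox (-R) R) (\<lambda>x. \<theta> x * v s x ^ 3)) has_field_derivative
          integral (cbox (-R) R) (\<lambda>x. \<theta> x * (3 * (v s x)\<^sup>2 * ut s x))) (at s within {0<..})"
      proof (rule leibniz_rule_field_derivative[where fx = "\<lambda>s x. \<theta> x * (3 * (v s x)\<^sup>2 * ut s x)"])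
        fix s x :: real assume "s \<in> {0<..}"
        then have "((\<lambda>s. u s x - p x) has_real_derivative ut s x) (at s)"
          using D(1)[of s x] ut[of s x] by (auto intro!: derivative_eq_intros)
        from DERIV_chain2[OF has_real_derivative_pos_part_power[of 3] this]
        have "((\<lambda>s. v s x ^ 3) has_real_derivative 3 * (v s x)\<^sup>2 * ut s x) (at s)"
          by (simp add: v_def)
        then show "((\<lambda>s. \<theta> x * v s x ^ 3) has_real_derivative \<theta> x * (3 * (v s x)\<^sup>2 * ut s x)) (at s within {0<..})"
          by (rule has_field_derivative_at_within[OF DERIV_cmult])
      next
        show "(\<lambda>x. \<theta> x * v s x ^ 3) integrable_on cbox (-R) R" if "s \<in> {0<..}" for s
          using that by (intro integrable_continuous continuous_intros cont\<theta> contv) auto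
      qed (use contI that in auto)
      then show ?thesis
        using that unfolding E_def I_def \<theta>_def by (simp add: at_within_open[of s "{0<..}"])
    qed
    have I: "I s \<le> 3 * K * E R s + 16 * M ^ 3 / R" if s: "0 < s" "s \<le> t" for s
    proof -
      \<comment> \<open>\<open>F\<close> collects the boundary terms of two integrations by parts.
        As the weight and its first derivative vanish at both ends, \<open>F'\<close> has integral
        0, so adding it to the pointwise upper bound replaces both integrations. It removes
        \<open>u_xx - p_xx\<close>, leaving a squared gradient of favourable sign and the term with
        \<open>\<theta>2\<close>.\<close>
      define F where "F = (\<lambda>x. \<theta> x * (3 * (v s x)\<^sup>2 * (deriv (u s) x - deriv p x)) - \<theta>1 x * v s x ^ 3)"
      define F' where "F' = (\<lambda>x. \<theta> x * (6 * v s x * (deriv (u s) x - deriv p x)\<^sup>2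
          + 3 * (v s x)\<^sup>2 * (deriv (deriv (u s)) x + f x (p x))) - \<theta>2 x * v s x ^ 3)"
      have dF: "(F has_real_derivative F' x) (at x)" for x
      proof -
        have dup: "((\<lambda>x. u s x - p x) has_real_derivative deriv (u s) x - deriv p x) (at x)"
          by (intro DERIV_diff D Dp s)
        have dv2: "((\<lambda>x. (v s x)\<^sup>2) has_real_derivative 2 * v s x * (deriv (u s) x - deriv p x)) (at x)"
          and dv3: "((\<lambda>x. v s x ^ 3) has_real_derivative 3 * (v s x)\<^sup>2 * (deriv (u s) x - deriv p x)) (at x)"
          using DERIV_chain2[OF has_real_derivative_pos_part_power[of 2] dup]
            DERIV_chain2[OF has_real_derivative_pos_part_power[of 3] dup] by (simp_all add: v_def)
        have dup': "((\<lambda>x. deriv (u s) x - deriv p x) has_real_derivative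
            deriv (deriv (u s)) x - (- f x (p x))) (at x)"
          by (intro DERIV_diff D Dp s)
        show ?thesis
          unfolding F_def F'_def
          by (rule DERIV_cong[OF DERIV_diff[OF DERIV_mult[OF d\<theta> DERIV_mult[OF DERIV_cmult[OF dv2] dup']]
                  DERIV_mult[OF d\<theta>1 dv3]]])
            (simp add: algebra_simps power2_eq_square)
      qed
      have "(F' has_integral F R - F (- R)) {-R..R}"
        using R dF by (intro fundamental_theorem_of_calculus)
          (auto simp flip: has_real_derivative_iff_has_vector_derivative intro: has_field_derivative_at_within)
      moreover have "F R = 0" "F (- R) = 0"
        using R by (simp_all add: F_def \<theta>_def \<theta>1_def)
      ultimately have F': "(F' has_integral 0) {-R..R}" by simp
      have "((\<lambda>x. 8 / R\<^sup>2 * M ^ 3) has_integral 8 / R\<^sup>2 * M ^ 3 * (R - - R)) {-R..R}"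
        using has_integral_const_real[of "8 / R\<^sup>2 * M ^ 3" "-R" R] R by (simp add: mult.commute)
      then have const: "((\<lambda>x. 8 / R\<^sup>2 * M ^ 3) has_integral 16 * M ^ 3 / R) {-R..R}"
        using R by (simp add: field_simps power2_eq_square)
      have "(\<lambda>x. \<theta> x * v s x ^ 3) integrable_on {-R..R}"
        using s by (intro integrable_continuous_real continuous_intros cont\<theta> contv)
      then have "((\<lambda>x. \<theta> x * v s x ^ 3) has_integral E R s) {-R..R}"
        unfolding E_def \<theta>_def by (rule integrable_integral)
      from has_integral_add[OF has_integral_add[OF has_integral_mult_right[OF this, of "3 * K"] const] F']
      have right: "((\<lambda>x. 3 * K * (\<theta> x * v s x ^ 3) + 8 / R\<^sup>2 * M ^ 3 + F' x) has_integral
          3 * K * E R s + 16 * M ^ 3 / R) {-R..R}"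
        by simp
      have "continuous_on {-R..R} (\<lambda>x. (\<lambda>(s, x). \<theta> x * (3 * (v s x)\<^sup>2 * ut s x)) (s, x))"
        by (rule continuous_on_compose2[OF contI]) (use s in \<open>auto intro!: continuous_intros\<close>)
      then have "(\<lambda>x. \<theta> x * (3 * (v s x)\<^sup>2 * ut s x)) integrable_on {-R..R}"
        by (intro integrable_continuous_real) simp
      then have left: "((\<lambda>x. \<theta> x * (3 * (v s x)\<^sup>2 * ut s x)) has_integral I s) {-R..R}"
        unfolding I_def by (rule integrable_integral)
      show ?thesis
      proof (rule has_integral_le[OF left right])
        fix x assume x: "x \<in> {-R..R}"
        have "(v s x)\<^sup>2 * (f x (u s x) - f x (p x)) \<le> (v s x)\<^sup>2 * (K * v s x)"
        proof (cases "p x \<le> u s x")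
          case True
          have "\<bar>f x (u s x) - f x (p x)\<bar> \<le> K * \<bar>u s x - p x\<bar>"
            using uM[OF s, of x] D(4)[OF s(1), of x] Dp(3)[of x] \<open>p x \<le> M\<close> by (intro K(2)) auto
          then show ?thesis
            using True by (intro mult_left_mono) (auto simp: v_def)
        qed (simp add: v_def)
        then have "\<theta> x * (3 * ((v s x)\<^sup>2 * (f x (u s x) - f x (p x)))) \<le> \<theta> x * (3 * ((v s x)\<^sup>2 * (K * v s x)))"
          by (rule mult_left_mono[OF mult_left_mono]) (use \<theta>(1)[OF x] in simp_all)
        moreover have "\<theta>2 x * v s x ^ 3 \<le> 8 / R\<^sup>2 * M ^ 3"
        proof -
          have "\<theta>2 x * v s x ^ 3 \<le> 8 / R\<^sup>2 * v s x ^ 3"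
            using \<theta>(3)[OF x] v(1) by (intro mult_right_mono) auto
          also have "\<dots> \<le> 8 / R\<^sup>2 * M ^ 3"
            using v[of s x] s by (intro mult_left_mono power_mono) auto
          finally show ?thesis .
        qed
        moreover have "0 \<le> \<theta> x * (6 * v s x * (deriv (u s) x - deriv p x)\<^sup>2)"
          using \<theta>(1)[OF x] v(1) by (intro mult_nonneg_nonneg) auto
        ultimately show "\<theta> x * (3 * (v s x)\<^sup>2 * ut s x)
            \<le> 3 * K * (\<theta> x * v s x ^ 3) + 8 / R\<^sup>2 * M ^ 3 + F' x"
          unfolding F'_def ut[OF s(1)] by (simp add: algebra_simps power2_eq_square power3_eq_cube)
      qed
    qed
    define b where "b = 16 * M ^ 3 / R"
    have "0 \<le> b" using \<open>0 < M\<close> R by (simp add: b_def)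
    \<comment> \<open>Gronwall in monotone form: \<open>I \<le> 3 * K * E + b\<close> and the
      exponential factor is at most 1, so \<open>G\<close> is nonincreasing.\<close>
    define G where "G = (\<lambda>s. exp (- (3 * K) * s) * E R s - b * s)"
    have G: "G t \<le> G s" if "0 < s" "s \<le> t" for s
    proof (rule DERIV_nonpos_imp_nonincreasing[OF that(2)])
      fix r assume r: "s \<le> r" "r \<le> t"
      then have "0 < r" using that by simp
      have "(G has_real_derivative exp (- (3 * K) * r) * (I r - 3 * K * E R r) - b) (at r)"
        unfolding G_def using dE[OF \<open>0 < r\<close>]
        by (auto intro!: derivative_eq_intros simp: algebra_simps)
      moreover have "exp (- (3 * K) * r) * (I r - 3 * K * E R r) \<le> exp (- (3 * K) * r) * b"
        using I[OF \<open>0 < r\<close> r(2)] by (intro mult_left_mono) (auto simp: b_def)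
      moreover have "exp (- (3 * K) * r) * b \<le> 1 * b"
        using K(1) \<open>0 < r\<close> \<open>0 \<le> b\<close> by (intro mult_right_mono) auto
      ultimately show "\<exists>y. (G has_real_derivative y) (at r) \<and> y \<le> 0"
        by (intro exI[of _ "exp (- (3 * K) * r) * (I r - 3 * K * E R r) - b"] conjI; linarith?)
    qed
    \<comment> \<open>Where \<open>u0 \<le> p\<close>, the positive part of \<open>u - p\<close> is
      at most \<open>\<bar>u - u0\<bar>\<close>; two of the three factors in the cube are bounded by
      \<open>M\<close>. This links the energy to the initial condition.\<close>
    have Es: "G s \<le> M\<^sup>2 * (LINT x:{-R..R}|lebesgue. \<bar>u s x - u0 x\<bar>)" if s: "0 < s" "s \<le> t" for s
    proof -
      have int1: "set_integrable lebesgue {-R..R} (\<lambda>x. \<theta> x * v s x ^ 3)"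
        using s by (intro absolutely_integrable_continuous_real continuous_intros cont\<theta> contv)
      have "set_integrable lebesgue {-R..R} (u s)"
        using s by (intro absolutely_integrable_continuous_real continuous_on_subset[OF contu]) auto
      then have int2: "set_integrable lebesgue {-R..R} (\<lambda>x. M\<^sup>2 * \<bar>u s x - u0 x\<bar>)"
        using initial_datum_set_integrable[OF meas ae P(2)]
        by (intro set_integrable_mult_right set_integrable_abs set_integral_diff(1)) auto
      have "0 \<le> E R s"
        unfolding E_def by (intro Henstock_Kurzweil_Integration.integral_nonneg
            set_lebesgue_integral_eq_integral(1)[OF int1[unfolded \<theta>_def]]) (simp add: v(1))
      then have "exp (- (3 * K) * s) * E R s \<le> E R s"
        using K(1) s by (intro mult_left_le_one_le) auto
      moreover have "0 \<le> b * s"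
        using \<open>0 \<le> b\<close> s by simp
      ultimately have "G s \<le> E R s"
        unfolding G_def by linarith
      also have "E R s = (LINT x:{-R..R}|lebesgue. \<theta> x * v s x ^ 3)"
        unfolding E_def using set_lebesgue_integral_eq_integral(2)[OF int1] by (simp add: \<theta>_def)
      also have "\<dots> \<le> (LINT x:{-R..R}|lebesgue. M\<^sup>2 * \<bar>u s x - u0 x\<bar>)"
      proof (rule set_integral_mono_AE[OF int1 int2])
        have "\<theta> x * v s x ^ 3 \<le> M\<^sup>2 * \<bar>u s x - u0 x\<bar>"
          if "0 \<le> u0 x \<and> u0 x \<le> p x" "x \<in> {-R..R}" for x
        proof -
          have "\<theta> x * v s x ^ 3 \<le> 1 * v s x ^ 3"
            using \<theta>(2)[OF that(2)] v(1) by (intro mult_right_mono) auto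
          also have "\<dots> = (v s x)\<^sup>2 * v s x"
            by (simp add: power2_eq_square power3_eq_cube)
          also have "\<dots> \<le> M\<^sup>2 * \<bar>u s x - u0 x\<bar>"
            using v[of s x] s that(1) by (intro mult_mono power_mono) (auto simp: v_def)
          finally show ?thesis .
        qed
        then show "AE x\<in>{-R..R} in lebesgue. \<theta> x * v s x ^ 3 \<le> M\<^sup>2 * \<bar>u s x - u0 x\<bar>"
          by (intro eventually_mono[OF ae]) blast
      qed
      finally show ?thesis by simp
    qed
    \<comment> \<open>\<open>G t\<close> lies below \<open>G s\<close> for every earlier positive
      \<open>s\<close>, and the bound on \<open>G s\<close> tends to 0 as \<open>s\<close> tends to
      0.\<close>
    have "G t \<le> 0"
    proof (rule tendsto_lowerbound)
      have "((\<lambda>s. LINT x:{-R..R}|lebesgue. \<bar>u s x - u0 x\<bar>) \<longlongrightarrow> 0) (at_right 0)"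
        using sol unfolding cauchy_solution_def by blast
      then show "((\<lambda>s. M\<^sup>2 * (LINT x:{-R..R}|lebesgue. \<bar>u s x - u0 x\<bar>)) \<longlongrightarrow> 0) (at_right 0)"
        by (rule tendsto_mult_right_zero)
      have "\<forall>\<^sub>F s in at_right 0. s \<in> {0<..<t}"
        using t by (rule eventually_at_right_real)
      then show "\<forall>\<^sub>F s in at_right 0. G t \<le> M\<^sup>2 * (LINT x:{-R..R}|lebesgue. \<bar>u s x - u0 x\<bar>)"
      proof (rule eventually_mono)
        show "G t \<le> M\<^sup>2 * (LINT x:{-R..R}|lebesgue. \<bar>u s x - u0 x\<bar>)" if "s \<in> {0<..<t}" for s
          using G[of s] Es[of s] that by simp
      qed
    qed simp
    then have "exp (3 * K * t) * (exp (- (3 * K) * t) * E R t) \<le> exp (3 * K * t) * (b * t)"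
      by (intro mult_left_mono) (auto simp: G_def)
    then show ?thesis
      by (simp add: b_def c_def mult.assoc[symmetric] flip: exp_add)
  qed
  note E_upper = this

  \<comment> \<open>Contradiction from a point where the solution exceeds the steady state\<close>
  define \<eta> where "\<eta> = (u t x0 - p x0) / 2"
  have "0 < \<eta>" using contra by (simp add: \<eta>_def)
  have "continuous_on UNIV (\<lambda>x. u t x - p x)"
    using contu[OF t] contp by (intro continuous_intros)
  then obtain d where d: "0 < d" "\<And>x. \<bar>x - x0\<bar> < d \<Longrightarrow> \<bar>(u t x - p x) - (u t x0 - p x0)\<bar> < \<eta>"
    using \<open>0 < \<eta>\<close> unfolding continuous_on_iff dist_real_def by (metis UNIV_I)
  \<comment> \<open>The first entry puts the interval of length \<open>d\<close> around
    \<open>x0\<close> inside the half-size interval, where the weight is at least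
    \<open>(3 / 4)\<^sup>2\<close>, hence at least \<open>1 / 2\<close>. The second makes the
    resulting lower bound \<open>d / 2 * \<eta> ^ 3\<close> exceed \<open>c / R\<close>.\<close>
  define R where "R = max (2 * (\<bar>x0\<bar> + d)) ((c + 1) / (d / 2 * \<eta> ^ 3))"
  have "0 < R" using d(1) by (simp add: R_def less_max_iff_disj add_nonneg_pos)
  have sub: "{x0 - d / 2..x0 + d / 2} \<subseteq> {-R..R}"
    using d(1) by (auto simp: R_def)
  have int: "(\<lambda>x. (1 - (x / R)\<^sup>2)\<^sup>2 * v t x ^ 3) integrable_on {a..b}" for a b
    using t \<open>0 < R\<close> by (intro integrable_continuous_real continuous_intros contv) auto
  have "d / 2 * \<eta> ^ 3 = integral {x0 - d / 2..x0 + d / 2} (\<lambda>x. 1 / 2 * \<eta> ^ 3)"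
    using d(1) by simp
  also have "\<dots> \<le> integral {x0 - d / 2..x0 + d / 2} (\<lambda>x. (1 - (x / R)\<^sup>2)\<^sup>2 * v t x ^ 3)"
  proof (intro integral_le int mult_mono power_mono)
    fix x assume x: "x \<in> {x0 - d / 2..x0 + d / 2}"
    then have "\<bar>x\<bar> \<le> R / 2"
      using d(1) unfolding R_def by (auto simp: max_def)
    then have "\<bar>x / R\<bar> \<le> 1 / 2"
      using \<open>0 < R\<close> by (simp add: field_simps)
    then have "(x / R)\<^sup>2 \<le> (1 / 2)\<^sup>2"
      by (simp only: abs_le_square_iff[symmetric] abs_divide abs_one abs_numeral)
    then have "(3 / 4)\<^sup>2 \<le> (1 - (x / R)\<^sup>2)\<^sup>2"
      by (intro power_mono) (auto simp: power2_eq_square)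
    moreover have "1 / 2 \<le> (3 / 4 :: real)\<^sup>2"
      by (simp add: power2_eq_square)
    ultimately show "1 / 2 \<le> (1 - (x / R)\<^sup>2)\<^sup>2"
      by (rule order_trans[rotated])
    show "\<eta> \<le> v t x"
    proof -
      have "\<bar>x - x0\<bar> < d" using x d(1) by auto
      from d(2)[OF this] have "\<eta> < u t x - p x"
        unfolding \<eta>_def by argo
      then show ?thesis by (simp add: v_def)
    qed
  qed (use \<open>0 < \<eta>\<close> in auto)
  also have "\<dots> \<le> E R t"
    unfolding E_def using sub int v(1) by (intro integral_subset_le) auto
  also have "\<dots> \<le> c / R" by (rule E_upper) fact
  finally have "R * (d / 2 * \<eta> ^ 3) \<le> c"
    using \<open>0 < R\<close> by (simp add: field_simps)
  moreover have "(c + 1) / (d / 2 * \<eta> ^ 3) \<le> R"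
    by (simp add: R_def)
  then have "c + 1 \<le> R * (d / 2 * \<eta> ^ 3)"
    using d(1) \<open>0 < \<eta>\<close> by (simp add: pos_divide_le_eq)
  ultimately show False by simp
qed

text \<open>If \<open>u\<close> vanished at all positive times, the \<open>L^1\<close> initial
  condition would force \<open>u0 = 0\<close> almost everywhere. So \<open>u\<close> is positive
  somewhere at some time \<open>T\<close>, and \<open>solution_positive\<close> spreads this to all
  points at later times; its lower bound on \<open>f\<close> follows from the Lipschitz estimate and
  \<open>f x 0 = 0\<close>.\<close>

lemma solution_eventually_positive:
  assumes sa: "standing_assumptions f"
    and sol: "cauchy_solution f u0 u"
    and le: "\<And>t x. 0 < t \<Longrightarrow> u t x \<le> P"
    and int: "\<And>R. set_integrable lebesgue {-R..R} u0"
    and nontrivial: "\<not> (AE x in lebesgue. u0 x = 0)"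
  obtains T where "0 < T" "\<And>t x. T < t \<Longrightarrow> 0 < u t x"
proof -
  note D = cauchy_solutionD[OF sol]
  have "\<exists>t>0. \<exists>x. u t x \<noteq> 0"
  proof (rule ccontr)
    assume "\<not> ?thesis"
    then have zero: "\<And>t x. 0 < t \<Longrightarrow> u t x = 0" by blast
    \<comment> \<open>Intervals with integer endpoints are taken so that only countably many null
      sets have to be united.\<close>
    have "AE x in lebesgue. indicator {- real n..real n} x *\<^sub>R \<bar>u0 x\<bar> = 0" for n
    proof -
      have "((\<lambda>t. LINT x:{- real n..real n}|lebesgue. \<bar>u t x - u0 x\<bar>) \<longlongrightarrow> 0) (at_right 0)"
        using sol unfolding cauchy_solution_def by blast
      moreover have "\<forall>\<^sub>F t in at_right 0. (LINT x:{- real n..real n}|lebesgue. \<bar>u t x - u0 x\<bar>)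
          = (LINT x:{- real n..real n}|lebesgue. \<bar>u0 x\<bar>)"
        using eventually_at_right_real[of 0 1] by (rule eventually_mono) (simp_all add: zero)
      ultimately have "((\<lambda>t::real. LINT x:{- real n..real n}|lebesgue. \<bar>u0 x\<bar>) \<longlongrightarrow> 0) (at_right 0)"
        by (rule Lim_transform_eventually)
      then have "(LINT x:{- real n..real n}|lebesgue. \<bar>u0 x\<bar>) = 0"
        by (simp add: tendsto_const_iff)
      moreover have "integrable lebesgue (\<lambda>x. indicator {- real n..real n} x *\<^sub>R \<bar>u0 x\<bar>)"
        using set_integrable_abs[OF int] unfolding set_integrable_def .
      ultimately show ?thesis
        unfolding set_lebesgue_integral_def by (subst (asm) integral_nonneg_eq_0_iff_AE) auto
    qed
    then have "AE x in lebesgue. \<forall>n. indicator {- real n..real n} x *\<^sub>R \<bar>u0 x\<bar> = 0"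
      unfolding AE_all_countable by blast
    then have "AE x in lebesgue. u0 x = 0"
    proof (rule eventually_mono)
      fix x assume *: "\<forall>n. indicator {- real n..real n} x *\<^sub>R \<bar>u0 x\<bar> = 0"
      obtain n where "\<bar>x\<bar> \<le> real n"
        using real_arch_simple by blast
      then have "x \<in> {- real n..real n}" by auto
      then show "u0 x = 0" using *[rule_format, of n] by simp
    qed
    with nontrivial show False by blast
  qed
  then obtain T x1 where T: "0 < T" "u T x1 \<noteq> 0" by blast
  then have "0 < u T x1" using D(4)[OF T(1), of x1] by simp
  obtain K where K: "0 \<le> K" "\<And>x a b. 0 \<le> a \<Longrightarrow> a \<le> P \<Longrightarrow> 0 \<le> b \<Longrightarrow> b \<le> P \<Longrightarrow> \<bar>f x a - f x b\<bar> \<le> K * \<bar>a - b\<bar>"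
    using standing_assumptions_lipschitz[OF sa] by blast
  have "0 < u t x" if "T < t" for t x
  proof (rule solution_positive[OF sol T(1) that _ \<open>0 < u T x1\<close>])
    fix s y assume "T \<le> s"
    then have "0 < s" using T(1) by simp
    have "f y 0 = 0" using sa unfolding standing_assumptions_def by blast
    then show "- K * u s y \<le> f y (u s y)"
      using K(2)[of "u s y" 0 y] D(4)[OF \<open>0 < s\<close>, of y] le[OF \<open>0 < s\<close>, of y] by auto
  qed
  with T(1) show ?thesis by (rule that)
qed

subsection \<open>Subsolutions built from the steady state\<close>

text \<open>Reduction of order: \<open>p\<close> and \<open>p * z\<close> both solve the linear
  equation \<open>w'' = (p'' / p) * w\<close>. In the second derivative the two terms
  \<open>p' h' / p^2\<close> cancel, so affine \<open>h\<close> gives exact solutions of that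
  equation and only \<open>h''\<close> remains as an error.\<close>

lemma steady_state_profile_derivatives:
  fixes h h' h'' :: "real \<Rightarrow> real"
  assumes st: "steady_state f p"
    and dz: "\<And>x. (z has_real_derivative 1 / (p x)\<^sup>2) (at x)"
    and dh: "\<And>y. (h has_real_derivative h' y) (at y)"
    and dh': "\<And>y. (h' has_real_derivative h'' y) (at y)"
  shows "((\<lambda>x. p x * h (z x)) has_real_derivative deriv p x * h (z x) + h' (z x) / p x) (at x)"
    and "((\<lambda>x. deriv p x * h (z x) + h' (z x) / p x) has_real_derivative
           h'' (z x) / p x ^ 3 - f x (p x) * h (z x)) (at x)"
proof -
  note D = steady_stateD[OF st]
  have "p x \<noteq> 0" using D(3)[of x] by simp
  have hz: "((\<lambda>x. h (z x)) has_real_derivative h' (z x) * (1 / (p x)\<^sup>2)) (at x)"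
    by (rule DERIV_chain2[OF dh dz])
  have hz': "((\<lambda>x. h' (z x)) has_real_derivative h'' (z x) * (1 / (p x)\<^sup>2)) (at x)"
    by (rule DERIV_chain2[OF dh' dz])
  show "((\<lambda>x. p x * h (z x)) has_real_derivative deriv p x * h (z x) + h' (z x) / p x) (at x)"
    by (rule DERIV_cong[OF DERIV_mult[OF D(1) hz]])
      (use \<open>p x \<noteq> 0\<close> in \<open>simp add: field_simps power2_eq_square\<close>)
  show "((\<lambda>x. deriv p x * h (z x) + h' (z x) / p x) has_real_derivative
      h'' (z x) / p x ^ 3 - f x (p x) * h (z x)) (at x)"
    by (rule DERIV_cong[OF DERIV_add[OF DERIV_mult[OF D(2) hz] DERIV_divide[OF hz' D(1) \<open>p x \<noteq> 0\<close>]]])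
      (use \<open>p x \<noteq> 0\<close> in \<open>simp add: field_simps power2_eq_square power3_eq_cube\<close>)
qed

text \<open>The comparison above, applied to \<open>w = p * h(z)\<close>. The bound
  \<open>h \<le> \<rho>\<close> makes the KPP gap available and gains \<open>\<delta> * w\<close>;
  the curvature of \<open>h\<close> costs at most \<open>\<kappa> / m ^ 4 * w\<close>. The
  difference \<open>\<delta> - \<kappa> / m ^ 4\<close> is the strictness margin.\<close>

lemma solution_exceeds_profile:
  fixes h h' h'' :: "real \<Rightarrow> real"
  assumes kpp: "heterogeneous_KPP f" and sa: "standing_assumptions f"
    and sol: "cauchy_solution f u0 u" and st: "steady_state f p"
    and dz: "\<And>x. (z has_real_derivative 1 / (p x)\<^sup>2) (at x)"
    and le: "\<And>t x. 0 < t \<Longrightarrow> u t x \<le> p x" "\<And>x. p x \<le> P"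
    and T: "0 < T" "\<And>x. 0 < u T x"
    and ab: "a \<le> b" "0 < m" "\<And>x. x \<in> {a..b} \<Longrightarrow> m \<le> p x"
    and gap: "\<And>x s s'. m \<le> s \<Longrightarrow> s \<le> P \<Longrightarrow> 0 < s' \<Longrightarrow> s' \<le> \<rho> * s \<Longrightarrow> f x s / s + \<delta> \<le> f x s' / s'"
    and dh: "\<And>y. (h has_real_derivative h' y) (at y)"
    and dh': "\<And>y. (h' has_real_derivative h'' y) (at y)"
    and h: "\<And>x. x \<in> {a..b} \<Longrightarrow> 0 \<le> h (z x) \<and> h (z x) \<le> \<rho>" "\<rho> \<le> 1"
    and h_pos: "\<And>x. a < x \<Longrightarrow> x < b \<Longrightarrow> 0 < h (z x)"
    and h_sub: "\<And>x. a < x \<Longrightarrow> x < b \<Longrightarrow> - \<kappa> * h (z x) \<le> h'' (z x)"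
    and \<kappa>: "0 \<le> \<kappa>" "\<kappa> < \<delta> * m ^ 4"
    and bdry: "\<And>t. T \<le> t \<Longrightarrow> p a * h (z a) \<le> u t a" "\<And>t. T \<le> t \<Longrightarrow> p b * h (z b) \<le> u t b"
  obtains T' where "T \<le> T'" "\<And>t x. T' \<le> t \<Longrightarrow> x \<in> {a..b} \<Longrightarrow> p x * h (z x) \<le> u t x"
proof (rule solution_exceeds_subsolution[OF kpp sa sol T(1) ab(1)])
  note D = steady_stateD[OF st]
  note dw = steady_state_profile_derivatives[OF st dz dh dh']
  show "0 < \<delta> - \<kappa> / m ^ 4"
    using \<kappa> ab(2) by (simp add: field_simps)
  show "continuous_on {a..b} (\<lambda>x. p x * h (z x))"
    using dw(1) DERIV_isCont continuous_at_imp_continuous_on by blast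
  show "((\<lambda>x. p x * h (z x)) has_real_derivative deriv p x * h (z x) + h' (z x) / p x) (at x)" for x
    by (rule dw)
  show "((\<lambda>x. deriv p x * h (z x) + h' (z x) / p x) has_real_derivative
      h'' (z x) / p x ^ 3 - f x (p x) * h (z x)) (at x)" for x
    by (rule dw)
  show "u t x \<le> P" if "T \<le> t" for t x
    using le(1)[of t x] le(2)[of x] that T(1) by simp
  show "p x * h (z x) \<le> P" if "x \<in> {a..b}" for x
  proof -
    have "h (z x) \<le> 1" using h(1)[OF that] h(2) by simp
    then have "p x * h (z x) \<le> p x"
      using D(3)[of x] by (intro mult_left_le) auto
    then show ?thesis using le(2) by (rule order_trans)
  qed
  show "0 \<le> p x * h (z x)" if "x \<in> {a..b}" for x
    using h(1)[OF that] D(3)[of x] by simp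
  show "(\<delta> - \<kappa> / m ^ 4) * (p x * h (z x)) \<le> h'' (z x) / p x ^ 3 - f x (p x) * h (z x) + f x (p x * h (z x))"
    if x: "a < x" "x < b" for x
  proof -
    let ?w = "p x * h (z x)"
    have px: "0 < p x" "m \<le> p x" using D(3) ab(3)[of x] x by auto
    have "0 < ?w" using px h_pos[OF x] by simp
    have "h (z x) \<le> \<rho>" using h(1)[of x] x by simp
    then have "?w \<le> \<rho> * p x"
      using px by (simp add: mult.commute)
    from gap[OF px(2) le(2) \<open>0 < ?w\<close> this]
    have "(f x (p x) / p x + \<delta>) * ?w \<le> f x ?w / ?w * ?w"
      using \<open>0 < ?w\<close> by (intro mult_right_mono) auto
    then have 1: "f x (p x) * h (z x) + \<delta> * ?w \<le> f x ?w"
      using px h_pos[OF x] by (simp add: algebra_simps)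
    have "- (\<kappa> / m ^ 4 * ?w) \<le> - (\<kappa> / p x ^ 4 * ?w)"
      using px \<kappa> ab(2) \<open>0 < ?w\<close>
      by (intro le_imp_neg_le mult_right_mono divide_left_mono power_mono mult_pos_pos zero_less_power) auto
    also have "\<dots> = - \<kappa> * h (z x) / p x ^ 3"
      using px by (simp add: field_simps power3_eq_cube power4_eq_xxxx)
    also have "\<dots> \<le> h'' (z x) / p x ^ 3"
      using h_sub[OF x] px by (intro divide_right_mono) auto
    finally show ?thesis
      using 1 by (simp add: algebra_simps)
  qed
  show "\<And>x. 0 < u T x" by (rule T(2))
  show "\<And>t. T \<le> t \<Longrightarrow> p a * h (z a) \<le> u t a" "\<And>t. T \<le> t \<Longrightarrow> p b * h (z b) \<le> u t b"
    by (rule bdry; assumption)+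
qed (rule that)

lemma inverse_square_antiderivative:
  assumes "steady_state f p"
  obtains z where "\<And>x. (z has_real_derivative 1 / (p x)\<^sup>2) (at x)"
proof -
  have "\<exists>F. \<forall>x::real. - \<infinity> < ereal x \<longrightarrow> ereal x < \<infinity> \<longrightarrow> (F has_vector_derivative 1 / (p x)\<^sup>2) (at x)"
  proof (rule einterval_antiderivative)
    show "isCont (\<lambda>x. 1 / (p x)\<^sup>2) x" for x
      using DERIV_isCont[OF steady_stateD(1)[OF assms, of x]] steady_stateD(3)[OF assms, of x]
      by (intro continuous_intros) auto
  qed simp
  then show ?thesis
    using that by (auto simp: has_real_derivative_iff_has_vector_derivative)
qed

lemma steady_state_bounded_below:
  assumes "steady_state f p"
  obtains m X where "0 < m" "\<And>x. X \<le> x \<Longrightarrow> m \<le> p x"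
proof -
  have "0 < Liminf at_top (\<lambda>x. ereal (p x))"
    using assms unfolding steady_state_def by blast
  then obtain m where m: "0 < ereal m" "ereal m < Liminf at_top (\<lambda>x. ereal (p x))"
    using ereal_dense2 by blast
  from less_LiminfD[OF m(2)] obtain X where "\<forall>x\<ge>X. ereal m < ereal (p x)"
    unfolding eventually_at_top_linorder by blast
  then show ?thesis using m(1) by (intro that[of m X]) auto
qed

text \<open>One factor \<open>1 - \<eta>\<close> is the amplitude that keeps the profiles a fixed
  ratio below \<open>p\<close>, as the KPP gap requires; the other is the loss due to the slope of
  the affine profile between \<open>-R\<close> and \<open>x1\<close>.\<close>

lemma solution_eventually_near_steady_state:
  assumes kpp: "heterogeneous_KPP f" and sa: "standing_assumptions f"
    and sol: "cauchy_solution f u0 u" and st: "steady_state f p"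
    and le: "\<And>t x. 0 < t \<Longrightarrow> u t x \<le> p x"
    and pos: "0 < T0" "\<And>t x. T0 < t \<Longrightarrow> 0 < u t x"
    and \<eta>: "0 < \<eta>" "\<eta> < 1" and "0 \<le> R"
  obtains T where "\<And>t x. T \<le> t \<Longrightarrow> x \<in> {-R..R} \<Longrightarrow> (1 - \<eta>)\<^sup>2 * p x \<le> u t x"
proof -
  note D = steady_stateD[OF st]
  define \<rho> where "\<rho> = 1 - \<eta>"
  have \<rho>: "0 < \<rho>" "\<rho> < 1" using \<eta> by (auto simp: \<rho>_def)
  obtain P where P: "0 < P" "\<And>x. p x \<le> P"
    using steady_state_bounded[OF st] by blast
  obtain m X where m: "0 < m" "\<And>x. X \<le> x \<Longrightarrow> m \<le> p x"
    using steady_state_bounded_below[OF st] by blast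
  obtain z where dz: "\<And>x. (z has_real_derivative 1 / (p x)\<^sup>2) (at x)"
    using inverse_square_antiderivative[OF st] by blast
  \<comment> \<open>Because \<open>p \<le> P\<close>, the coordinate \<open>z\<close> grows at least
    at rate \<open>1 / P\<^sup>2\<close>. It is therefore unbounded in both directions, and a
    \<open>z\<close>-distance \<open>l\<close> is covered within an \<open>x\<close>-distance
    \<open>l * P\<^sup>2\<close>.\<close>
  have z_slope: "(y - x) / P\<^sup>2 \<le> z y - z x" if "x \<le> y" for x y
  proof (cases "x = y")
    case False
    then have "x < y" using that by simp
    then obtain \<xi> where "z y - z x = (y - x) * (1 / (p \<xi>)\<^sup>2)"
      using MVT2[of x y z "\<lambda>x. 1 / (p x)\<^sup>2"] dz by blast
    moreover have "(p \<xi>)\<^sup>2 \<le> P\<^sup>2"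
      using P(2) D(3) by (intro power_mono) (auto simp: less_imp_le)
    then have "(y - x) / P\<^sup>2 \<le> (y - x) / (p \<xi>)\<^sup>2"
      using D(3)[of \<xi>] P(1) \<open>x < y\<close> by (intro divide_left_mono) auto
    ultimately show ?thesis by simp
  qed simp
  have z_mono: "z x \<le> z y" if "x \<le> y" for x y
    using z_slope[OF that] that P(1) by (smt (verit) divide_nonneg_nonneg zero_le_power2)
  have z_strict: "z x < z y" if "x < y" for x y
    using z_slope[of x y] that P(1) by (smt (verit) divide_pos_pos zero_less_power)
  have cont_z: "isCont z x" for x
    using dz DERIV_isCont by blast

  \<comment> \<open>Cosine profile far to the right\<close>
  obtain \<delta> where \<delta>: "0 < \<delta>" "\<And>x s s'. m \<le> s \<Longrightarrow> s \<le> P \<Longrightarrow> 0 < s' \<Longrightarrow> s' \<le> \<rho> * s \<Longrightarrow> f x s / s + \<delta> \<le> f x s' / s'"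
    using KPP_uniform_gap[OF kpp m(1) \<rho>] by blast
  \<comment> \<open>Half of the threshold \<open>\<delta> * m ^ 4\<close> up to which
    \<open>solution_exceeds_profile\<close> tolerates curvature.\<close>
  define k where "k = sqrt (\<delta> * m ^ 4 / 2)"
  have k: "0 < k" "k\<^sup>2 = \<delta> * m ^ 4 / 2"
    using \<delta>(1) m(1) by (simp_all add: k_def)
  \<comment> \<open>A quarter period: the cosine centred at \<open>z x1\<close> first vanishes at
    \<open>z\<close>-distance \<open>l\<close>.\<close>
  define l where "l = pi / (2 * k)"
  have l: "0 < l" "k * l = pi / 2" using k(1) by (simp_all add: l_def)
  \<comment> \<open>Lying to the right of \<open>R\<close>, \<open>x1\<close> can serve as right end
    of the second stage; lying \<open>l * P\<^sup>2\<close> beyond \<open>X\<close>, it keeps the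
    left zero \<open>a\<close> of the cosine in the region where \<open>m \<le> p\<close>.\<close>
  define x1 where "x1 = max R (X + l * P\<^sup>2)"
  have "l * P\<^sup>2 / P\<^sup>2 \<le> (x1 - X) / P\<^sup>2"
    by (intro divide_right_mono) (auto simp: x1_def)
  moreover have "X \<le> x1" using l(1) by (simp add: x1_def le_max_iff_disj)
  ultimately have "z X \<le> z x1 - l"
    using z_slope[of X x1] P(1) by simp
  then obtain a where a: "X \<le> a" "a \<le> x1" "z a = z x1 - l"
    using IVT[of z X "z x1 - l" x1] cont_z \<open>X \<le> x1\<close> l(1) by auto
  have "z x1 + l \<le> z (x1 + l * P\<^sup>2)"
    using z_slope[of x1 "x1 + l * P\<^sup>2"] l(1) P(1) by simp
  then obtain b where b: "x1 \<le> b" "z b = z x1 + l"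
    using IVT[of z x1 "z x1 + l" "x1 + l * P\<^sup>2"] cont_z l(1) by auto
  define T1 where "T1 = T0 + 1"
  have T1: "0 < T1" "\<And>t x. T1 \<le> t \<Longrightarrow> 0 < u t x"
    using pos by (auto simp: T1_def)
  obtain T2 where T2: "T1 \<le> T2"
    "\<And>t x. T2 \<le> t \<Longrightarrow> x \<in> {a..b} \<Longrightarrow> p x * (\<rho> * cos (k * (z x - z x1))) \<le> u t x"
  proof (rule solution_exceeds_profile[OF kpp sa sol st dz le P(2) T1(1) T1(2) _ m(1) _ \<delta>(2), where a = a and b = b
        and h = "\<lambda>y. \<rho> * cos (k * (y - z x1))" and h' = "\<lambda>y. - \<rho> * k * sin (k * (y - z x1))"
        and h'' = "\<lambda>y. - k\<^sup>2 * (\<rho> * cos (k * (y - z x1)))" and \<kappa> = "k\<^sup>2"])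
    have kz: "\<bar>k * (z x - z x1)\<bar> \<le> pi / 2" if "x \<in> {a..b}" for x
    proof -
      have "\<bar>z x - z x1\<bar> \<le> l"
        using z_mono[of a x] z_mono[of x b] that a b by auto
      then have "k * \<bar>z x - z x1\<bar> \<le> k * l"
        using k(1) by (intro mult_left_mono) auto
      then show ?thesis using l(2) k(1) by (simp add: abs_mult)
    qed
    show "0 \<le> \<rho> * cos (k * (z x - z x1)) \<and> \<rho> * cos (k * (z x - z x1)) \<le> \<rho>" if "x \<in> {a..b}" for x
      using kz[OF that] \<rho> cos_ge_zero[of "k * (z x - z x1)"] by (auto intro: mult_left_le)
    show "0 < \<rho> * cos (k * (z x - z x1))" if "a < x" "x < b" for x
    proof -
      have "\<bar>z x - z x1\<bar> < l"
        using z_strict[of a x] z_strict[of x b] that a b by auto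
      then have "k * \<bar>z x - z x1\<bar> < k * l"
        using k(1) by (intro mult_strict_left_mono) auto
      then have "\<bar>k * (z x - z x1)\<bar> < pi / 2" using l(2) k(1) by (simp add: abs_mult)
      then show ?thesis using \<rho>(1) cos_gt_zero_pi[of "k * (z x - z x1)"] by (auto simp: abs_less_iff)
    qed
    show "((\<lambda>y. \<rho> * cos (k * (y - z x1))) has_real_derivative - \<rho> * k * sin (k * (y - z x1))) (at y)" for y
      by (auto intro!: derivative_eq_intros)
    show "((\<lambda>y. - \<rho> * k * sin (k * (y - z x1))) has_real_derivative - k\<^sup>2 * (\<rho> * cos (k * (y - z x1)))) (at y)" for y
      by (auto intro!: derivative_eq_intros simp: power2_eq_square)
    show "k\<^sup>2 < \<delta> * m ^ 4" using k(1) zero_less_power[OF k(1), of 2] unfolding k(2) by linarith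
    \<comment> \<open>The profile vanishes at \<open>a\<close> and \<open>b\<close>, so positivity
      of \<open>u\<close> is all that the boundary conditions ask for.\<close>
    have "z a - z x1 = - l" "z b - z x1 = l"
      using a b by simp_all
    then have "k * (z a - z x1) = - (pi / 2)" "k * (z b - z x1) = pi / 2"
      using l(2) by (simp_all only: mult_minus_right)
    then show "p a * (\<rho> * cos (k * (z a - z x1))) \<le> u t a" "p b * (\<rho> * cos (k * (z b - z x1))) \<le> u t b"
      if "T1 \<le> t" for t
      using T1(2)[OF that, of a] T1(2)[OF that, of b]
      by (simp_all only: cos_minus cos_pi_half mult_zero_right less_imp_le)
  qed (use a b m \<rho> in auto)
  \<comment> \<open>At the crest of the cosine; this becomes the right boundary condition of the
    affine profile.\<close>
  have T2': "p x1 * \<rho> \<le> u t x1" if "T2 \<le> t" for t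
    using T2(2)[OF that, of x1] a b by simp

  \<comment> \<open>Affine profile to the left\<close>
  define Z where "Z = z x1 - z (- R)"
  have "- R \<le> x1" using \<open>0 \<le> R\<close> by (simp add: x1_def le_max_iff_disj)
  then have "0 \<le> Z" using z_mono by (simp add: Z_def)
  \<comment> \<open>With slope \<open>1 / L\<close> in \<open>z\<close>, the relative loss over the
    \<open>z\<close>-distance \<open>Z\<close> from \<open>x1\<close> to \<open>-R\<close> is at
    most \<open>\<eta>\<close>. The added 1 keeps \<open>L\<close> positive when
    \<open>Z = 0\<close>.\<close>
  define L where "L = (Z + 1) / \<eta>"
  have "0 < L" using \<open>0 \<le> Z\<close> \<eta> by (simp add: L_def)
  have "Z \<le> \<eta> * L" using \<eta> by (simp add: L_def)
  have "\<eta> * L \<le> L" using \<open>0 < L\<close> \<eta> by simp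
  with \<open>Z \<le> \<eta> * L\<close> have "Z \<le> L" by simp
  \<comment> \<open>Far enough left for the intermediate value theorem to yield \<open>a'\<close>,
    the zero of the affine profile, to the left of \<open>-R\<close>.\<close>
  define y0 where "y0 = - R - L * P\<^sup>2"
  have "z y0 \<le> z x1 - L"
    using z_slope[of y0 "- R"] z_mono[OF \<open>- R \<le> x1\<close>] \<open>0 < L\<close> P(1) by (simp add: y0_def)
  moreover have "z x1 - L \<le> z (- R)"
    using \<open>Z \<le> L\<close> by (simp add: Z_def)
  moreover have "y0 \<le> - R" using \<open>0 < L\<close> by (simp add: y0_def)
  ultimately obtain a' where a': "a' \<le> - R" "z a' = z x1 - L"
    using IVT[of z y0 "z x1 - L" "- R"] cont_z by auto
  have "a' \<le> x1" using a' \<open>- R \<le> x1\<close> by simp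
  have "continuous_on {a'..x1} p"
    using D(1) DERIV_isCont continuous_at_imp_continuous_on by blast
  then have "\<exists>y\<in>{a'..x1}. \<forall>x\<in>{a'..x1}. p y \<le> p x"
    using \<open>a' \<le> x1\<close> by (intro continuous_attains_inf) auto
  then obtain y where y: "\<And>x. x \<in> {a'..x1} \<Longrightarrow> p y \<le> p x"
    by blast
  \<comment> \<open>Even if \<open>p\<close> decays on the left, its minimum \<open>p y\<close> over
    the bounded interval from \<open>a'\<close> to \<open>x1\<close> is positive and yields a gap.
    How small \<open>\<delta>'\<close> is does not matter, since the affine profile has
    \<open>\<kappa> = 0\<close>.\<close>
  obtain \<delta>' where \<delta>': "0 < \<delta>'" "\<And>x s s'. p y \<le> s \<Longrightarrow> s \<le> P \<Longrightarrow> 0 < s' \<Longrightarrow> s' \<le> \<rho> * s \<Longrightarrow> f x s / s + \<delta>' \<le> f x s' / s'"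
    using KPP_uniform_gap[OF kpp D(3)[of y] \<rho>] by blast
  have T2pos: "0 < T2" "\<And>x. 0 < u T2 x" using T1 T2(1) by auto
  obtain T3 where T3: "T2 \<le> T3"
    "\<And>t x. T3 \<le> t \<Longrightarrow> x \<in> {a'..x1} \<Longrightarrow> p x * (\<rho> * (1 - (z x1 - z x) / L)) \<le> u t x"
  proof (rule solution_exceeds_profile[OF kpp sa sol st dz le P(2) T2pos \<open>a' \<le> x1\<close> D(3)[of y] y \<delta>'(2),
        where h = "\<lambda>y. \<rho> * (1 - (z x1 - y) / L)" and h' = "\<lambda>y. \<rho> / L" and h'' = "\<lambda>y. 0" and \<kappa> = 0])
    show "0 \<le> \<rho> * (1 - (z x1 - z x) / L) \<and> \<rho> * (1 - (z x1 - z x) / L) \<le> \<rho>" if "x \<in> {a'..x1}" for x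
    proof -
      have "0 \<le> (z x1 - z x) / L" "(z x1 - z x) / L \<le> 1"
        using z_mono[of a' x] z_mono[of x x1] a' that \<open>0 < L\<close> by simp_all
      then show ?thesis
        using \<rho>(1) by (intro conjI mult_nonneg_nonneg mult_left_le) auto
    qed
    show "0 < \<rho> * (1 - (z x1 - z x) / L)" if "a' < x" for x
    proof -
      have "(z x1 - z x) / L < 1"
        using z_strict[OF that] a' \<open>0 < L\<close> by simp
      then show ?thesis
        using \<rho>(1) by simp
    qed
    show "((\<lambda>y. \<rho> * (1 - (z x1 - y) / L)) has_real_derivative \<rho> / L) (at y)" for y
      using \<open>0 < L\<close> by (auto intro!: derivative_eq_intros simp: field_simps)
    show "p a' * (\<rho> * (1 - (z x1 - z a') / L)) \<le> u t a'" if "T2 \<le> t" for t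
      using T1(2)[of t a'] T2(1) that a' \<open>0 < L\<close> by simp
    show "p x1 * (\<rho> * (1 - (z x1 - z x1) / L)) \<le> u t x1" if "T2 \<le> t" for t
      using T2'[OF that] by simp
  qed (use \<rho> \<delta>' D(3)[of y] in auto)
  show ?thesis
  proof (rule that[of T3])
    fix t x assume t: "T3 \<le> t" and x: "x \<in> {-R..R}"
    have "R \<le> x1" by (simp add: x1_def)
    have "z x1 - z x \<le> \<eta> * L"
      using z_mono[of "- R" x] x \<open>Z \<le> \<eta> * L\<close> by (simp add: Z_def)
    then have "\<rho> \<le> 1 - (z x1 - z x) / L"
      using \<open>0 < L\<close> by (simp add: \<rho>_def field_simps)
    then have "p x * (\<rho> * \<rho>) \<le> p x * (\<rho> * (1 - (z x1 - z x) / L))"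
      using D(3)[of x] \<rho> by (intro mult_left_mono) auto
    also have "\<dots> \<le> u t x"
      using T3(2)[OF t] x a' \<open>R \<le> x1\<close> by simp
    finally show "(1 - \<eta>)\<^sup>2 * p x \<le> u t x"
      by (simp add: \<rho>_def power2_eq_square mult_ac)
  qed
qed

theorem theorem1p5:
  fixes f :: "real \<Rightarrow> real \<Rightarrow> real"
    and p u0 :: "real \<Rightarrow> real"
    and u :: "real \<Rightarrow> real \<Rightarrow> real"
  assumes "standing_assumptions f"
    and "heterogeneous_KPP f"
    and "close_to_periodic f"
    and "steady_state f p"
    and "u0 \<in> borel_measurable lebesgue"
    and "AE x in lebesgue. 0 \<le> u0 x \<and> u0 x \<le> p x"
    and "\<not> (AE x in lebesgue. u0 x = 0)"
    and "cauchy_solution f u0 u"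
  shows "\<forall>K. compact K \<longrightarrow> uniform_limit K u p at_top"
proof (intro allI impI uniform_limitI)
  fix K :: "real set" and e :: real
  assume "compact K" "0 < e"
  have le: "u t x \<le> p x" if "0 < t" for t x
    using solution_le_steady_state[OF assms(1,8,4,5,6) that] .
  obtain P where P: "0 < P" "\<And>x. p x \<le> P"
    using steady_state_bounded[OF assms(4)] by blast
  obtain T0 where T0: "0 < T0" "\<And>t x. T0 < t \<Longrightarrow> 0 < u t x"
  proof (rule solution_eventually_positive[OF assms(1,8) _ _ assms(7), where P = P])
    show "u t x \<le> P" if "0 < t" for t x
      using le[OF that, of x] P(2)[of x] by simp
    show "set_integrable lebesgue {-R..R} u0" for R
      by (rule initial_datum_set_integrable[OF assms(5,6) P(2)])
  qed blast
  obtain B where "\<forall>x\<in>K. \<bar>x\<bar> \<le> B"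
    using compact_imp_bounded[OF \<open>compact K\<close>] unfolding bounded_real by blast
  \<comment> \<open>For empty \<open>K\<close> the bound \<open>B\<close> may be negative, whereas
    the radius has to be nonnegative.\<close>
  then have K: "K \<subseteq> {- max 0 B..max 0 B}"
    by (force simp: abs_le_iff)
  \<comment> \<open>The relative loss \<open>1 - (1 - \<eta>)\<^sup>2\<close> is at most
    \<open>2 * \<eta>\<close>; multiplied by \<open>P\<close> it is at most \<open>e / 2\<close>.
    The cap \<open>1 / 2\<close> ensures \<open>\<eta> < 1\<close>.\<close>
  define \<eta> where "\<eta> = min (1 / 2) (e / (4 * P))"
  have \<eta>: "0 < \<eta>" "\<eta> < 1" using \<open>0 < e\<close> P(1) by (auto simp: \<eta>_def)
  have "2 * \<eta> * P \<le> e / 2"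
    using P(1) mult_right_mono[of \<eta> "e / (4 * P)" "2 * P"] by (simp add: \<eta>_def)
  then have "2 * \<eta> * P < e" using \<open>0 < e\<close> by simp
  obtain T where T: "\<And>t x. T \<le> t \<Longrightarrow> x \<in> {- max 0 B..max 0 B} \<Longrightarrow> (1 - \<eta>)\<^sup>2 * p x \<le> u t x"
    using solution_eventually_near_steady_state[OF assms(2,1,8,4) le T0 \<eta>, of "max 0 B"] by auto
  have "\<forall>x\<in>K. dist (u t x) (p x) < e" if "max 1 T \<le> t" for t
  proof
    fix x assume "x \<in> K"
    then have "(1 - \<eta>)\<^sup>2 * p x \<le> u t x"
      using T[of t x] K that by auto
    moreover have "(1 - 2 * \<eta>) * p x \<le> (1 - \<eta>)\<^sup>2 * p x"
      using steady_stateD(3)[OF assms(4), of x]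
      by (intro mult_right_mono) (auto simp: power2_eq_square algebra_simps)
    moreover have "2 * \<eta> * p x \<le> 2 * \<eta> * P"
      using P(2) \<eta> by (intro mult_left_mono) auto
    moreover have "u t x \<le> p x" using le that by simp
    ultimately show "dist (u t x) (p x) < e"
      using \<open>2 * \<eta> * P < e\<close> by (simp add: dist_real_def algebra_simps)
  qed
  then show "\<forall>\<^sub>F t in at_top. \<forall>x\<in>K. dist (u t x) (p x) < e"
    unfolding eventually_at_top_linorder by blast
qed

end
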